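(* (i) The actions $s_j$ and $\tilde s_i$ are compatible with $\bar R_j$ and $\tilde R_i$: for $\underline x\in\mathcal X$, $$\rho\circ\bar R_j(\underline x)=s_j^*\circ\rho(\underline x)\quad(j\in\mathbb Z/m\mathbb Z),\qquad\rho\circ\tilde R_i(\underline x)=\tilde s_i^*\circ\rho(\underline x)\quad(i\in\mathbb Z/N\mathbb Z).$$ (ii) $\rho\circ\hat R_i(\underline x)=\rho(\underline x)$ for $i=1,\dots,M$. (iii) The snake path action satisfies $T_i^*\circ\rho(\underline x)=\rho(\underline x)$ for $i=1,\dots,M$. Here, for a rational map $F$ of $\mathcal X$, $\rho\circ F(\underline x)$ denotes the tuple of functions on $\mathcal M$ obtained by applying $\rho$ to the components of $F(\underline x)$ written as rational functions of the $x_{l,h}$ (in (ii), after cancelling the common factor $1-\prod_s\alpha_s$ from numerators and denominators), and $s^*$ denotes pullback of functions on $\mathcal M$.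
   Context: Fix integers $n\ge2$, $m\ge1$, $1\le k\le n$; $N=\gcd(n,k)$, $n'=n/N$, $M=\gcd(n,m+k)$. Spaces. $\mathcal M=\mathbb C^{mn}$ with coordinates $q_{j,i}$ ($1\le j\le m$, $1\le i\le n$), extended to $(j,i)\in\mathbb Z^2$ by $q_{j,i+n}=q_{j,i}$, $q_{m+j,i}=q_{j,i-k}$. $\mathcal X=\mathbb C^{mn}$ with coordinates $\underline x=(x_{j,i})$ (face weights of a honeycomb graph on a torus), extended by $x_{j,i+n}=x_{j,i}$, $x_{m+j,i}=x_{j,i-k}$. The substitution $\rho$ of functions on $\mathcal X$ by functions on $\mathcal M$ is $\rho(x_{j,i})=q_{j,i+1}/q_{j+1,i}$ (so $\rho(x_{m,i})=q_{m,i+1}/q_{1,i-k}$). Local transformation. Given $\alpha=(\alpha_i,\beta_i,\gamma_i)_{i\in\mathbb Z/L\mathbb Z}$, set $\omega_i=\omega_i(\alpha_1,\dots,\alpha_L)=\frac{\alpha_i\sum_{t=0}^{L-1}\prod_{s=1}^t\alpha_{i-s}}{1-\prod_{s=1}^L\alpha_s}$ and let $R_\alpha$ be $(\alpha_i,\beta_i,\gamma_i)\mapsto\big(\omega_{i-1}^{-1}(1+\omega_i),\ \beta_i(1+\omega_{i-1}^{-1})^{-1},\ \gamma_i(1+\omega_i^{-1})^{-1}\big)$. Actions on $\mathcal X$ (each changes only the listed variables): $\bar R_j$ is $R_\alpha$ with $L=n$, $(\alpha_i,\beta_i,\gamma_i)=(x_{j,i},x_{j-1,i},x_{j+1,i})$,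 $i\in\mathbb Z/n$; $\tilde R_i$ is $R_\alpha$ with $L=mn'$, $(\alpha_l,\beta_l,\gamma_l)=(x_{m-l,N-i},x_{m-l,N-i+1},x_{m-l,N-i-1})$, $l\in\mathbb Z/mn'$; $\hat R_i$ is $R_\alpha$ with $L=mn/M$, $(\alpha_j,\beta_j,\gamma_j)=(x_{j,i+1-j},x_{j,i+2-j},x_{j,i-j})$, $j\in\mathbb Z/\frac{mn}M$. If the neighbouring $\beta$- and $\gamma$-rows coincide, a variable occurring in both is multiplied by both factors. The statements about $\bar R_j,s_j$; $\tilde R_i,\tilde s_i$; $\hat R_i$ are for $m\ge2$; $N\ge2$; $M\ge2$ respectively. Actions on $\mathcal M$. For $\mathbf a=(a_1,\dots,a_l)$ put $\mathbf a^{(i)}=(a_{i+1},\dots,a_l,a_1,\dots,a_i)$; $E(\mathbf a,\mathbf b)=\sum_{i=0}^{l-1}\prod_{h=1}^ib_h\prod_{h=i+2}^{l}a_h$; $R(\mathbf a,\mathbf b)=(\mathbf b',\mathbf a')$, $b_i'=b_iE_i/E_{i-1}$, $a_i'=a_iE_{i-1}/E_i$, $E_i=E(\mathbf a^{(i)},\mathbf b^{(i)})$. $s_r$ ($1\le r\le m-1$) replaces $((q_{r,i})_{i\in[n]},(q_{r+1,i})_{i\in[n]})$ by its image under $R$; $\pi(q)_{j,i}=q_{j+1,i}$; $s_0=\pi s_1\pi^{-1}$. With $\tilde q_{r,l}=q_{m+1-l,N+1-r}$ ($1\le r\le N$, $1\le l\le mn'$), $\tilde s_r$ ($1\le r\le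 N-1$) replaces $((\tilde q_{r,l})_l,(\tilde q_{r+1,l})_l)$ by its image under $R$; $\tilde\pi(q)_{j,i}=q_{j,i-1}$; $\tilde s_0=\tilde\pi\tilde s_1\tilde\pi^{-1}$. For $\lambda\in\mathbb C^*$ and $1\le s\le M$, the snake path action $T_s=T_s(\lambda)$ multiplies $q_{j,i}$ by $\lambda$ if $i\equiv s-j+1\bmod M$ and by $\lambda^{-1}$ if $i\equiv s-j\bmod M$, leaving the others unchanged (if $M=1$ both factors apply). *)

theory Defs
  imports
    Complex_Main
    "HOL-Library.Poly_Mapping"
    "HOL-Library.Product_Lexorder"
    "HOL-Computational_Algebra.Fraction_Field"
begin

section \<open>Rational functions and substitution\<close>

text \<open>
  Polynomials and rational functions over the complex numbers in variables indexed by
  pairs of integers.  The coordinates of both spaces use only the \<open>m n\<close> variables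
  \<open>(j, i)\<close> with \<open>1 \<le> j \<le> m\<close>, \<open>1 \<le> i \<le> n\<close>.  The lexicographic order on index pairs only
  serves to obtain the integral domain instance.
\<close>

type_synonym cpoly = "((int \<times> int) \<Rightarrow>\<^sub>0 nat) \<Rightarrow>\<^sub>0 complex"
type_synonym ratfun = "cpoly fract"

definition rconst :: "complex \<Rightarrow> ratfun" where
  "rconst c = Fract (Poly_Mapping.single 0 c) 1"

definition rvar :: "int \<times> int \<Rightarrow> ratfun" where
  "rvar v = Fract (Poly_Mapping.single (Poly_Mapping.single v 1) 1) 1"

definition poly_subst :: "(int \<times> int \<Rightarrow> ratfun) \<Rightarrow> cpoly \<Rightarrow> ratfun" where
  "poly_subst \<sigma> P =
     (\<Sum>mon\<in>Poly_Mapping.keys P. rconst (Poly_Mapping.lookup P mon) *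
        (\<Prod>v\<in>Poly_Mapping.keys mon. \<sigma> v ^ Poly_Mapping.lookup mon v))"

text \<open>
  Substitution into a rational function is partial: it is defined on those functions that can
  be written as a quotient whose denominator does not vanish identically after substitution.
  The value does not depend on the chosen quotient.
\<close>

definition substitutable :: "(int \<times> int \<Rightarrow> ratfun) \<Rightarrow> ratfun \<Rightarrow> bool" where
  "substitutable \<sigma> f \<longleftrightarrow> (\<exists>P Q. f = Fract P Q \<and> poly_subst \<sigma> Q \<noteq> 0)"

definition rat_subst :: "(int \<times> int \<Rightarrow> ratfun) \<Rightarrow> ratfun \<Rightarrow> ratfun" where
  "rat_subst \<sigma> f =
     (THE g. \<exists>P Q. f = Fract P Q \<and> poly_subst \<sigma> Q \<noteq> 0 \<and> g = poly_subst \<sigma> P / poly_subst \<sigma> Q)"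


section \<open>Doubly quasi-periodic arrays\<close>

text \<open>
  A point of either space is an array \<open>x\<close> on all of \<open>\<int> \<times> \<int>\<close> subject to
  \<open>x (j, i + n) = x (j, i)\<close> and \<open>x (m + j, i) = x (j, i - k)\<close>.  Positions are identified by their
  representative in \<open>{1..m} \<times> {1..n}\<close>.
\<close>

definition rep :: "int \<Rightarrow> int \<Rightarrow> int \<Rightarrow> int \<times> int \<Rightarrow> int \<times> int" where
  "rep m n k = (\<lambda>(j, i). ((j - 1) mod m + 1, (i - k * ((j - 1) div m) - 1) mod n + 1))"

text \<open>
  The generic point, i.e. the tuple of coordinate functions.  A rational map is represented
  by its tuple of components, which is its defining formula evaluated at the generic point.
\<close>

definition generic :: "int \<Rightarrow> int \<Rightarrow> int \<Rightarrow> int \<times> int \<Rightarrow> ratfun" where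
  "generic m n k z = rvar (rep m n k z)"

text \<open>
  Replace the entries at the positions \<open>p l\<close>, \<open>l \<in> A\<close>, by \<open>v l\<close>; these positions are to
  represent pairwise distinct coordinates.
\<close>

definition put :: "int \<Rightarrow> int \<Rightarrow> int \<Rightarrow> int set \<Rightarrow> (int \<Rightarrow> int \<times> int) \<Rightarrow> (int \<Rightarrow> 'a) \<Rightarrow>
    (int \<times> int \<Rightarrow> 'a) \<Rightarrow> int \<times> int \<Rightarrow> 'a" where
  "put m n k A p v x = (\<lambda>z.
     if \<exists>l\<in>A. rep m n k (p l) = rep m n k z
     then v (THE l. l \<in> A \<and> rep m n k (p l) = rep m n k z)
     else x z)"


section \<open>Actions on the face weights\<close>

definition omega :: "int \<Rightarrow> (int \<Rightarrow> 'a::field) \<Rightarrow> int \<Rightarrow> 'a" where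
  "omega L \<alpha> i =
     \<alpha> i * (\<Sum>t\<in>{0..L - 1}. \<Prod>s\<in>{1..t}. \<alpha> (i - s)) / (1 - (\<Prod>s\<in>{1..L}. \<alpha> s))"

text \<open>
  The local transformation with \<open>\<alpha>\<^sub>i\<close>, \<open>\<beta>\<^sub>i\<close>, \<open>\<gamma>\<^sub>i\<close> located at the positions \<open>a i\<close>, \<open>b i\<close>, \<open>c i\<close>.
  The \<open>\<beta>\<close>- and \<open>\<gamma>\<close>-factors are applied one after the other, so that a variable
  occurring in both rows receives both.
\<close>

definition local_R :: "int \<Rightarrow> int \<Rightarrow> int \<Rightarrow> int \<Rightarrow> (int \<Rightarrow> int \<times> int) \<Rightarrow> (int \<Rightarrow> int \<times> int) \<Rightarrow>
    (int \<Rightarrow> int \<times> int) \<Rightarrow> (int \<times> int \<Rightarrow> 'a::field) \<Rightarrow> int \<times> int \<Rightarrow> 'a" where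
  "local_R m n k L a b c x =
     (let \<omega> = omega L (\<lambda>i. x (a i));
          y = put m n k {0..<L} b (\<lambda>i. x (b i) * inverse (1 + inverse (\<omega> (i - 1)))) x;
          z = put m n k {0..<L} c (\<lambda>i. y (c i) * inverse (1 + inverse (\<omega> i))) y
      in put m n k {0..<L} a (\<lambda>i. inverse (\<omega> (i - 1)) * (1 + \<omega> i)) z)"

definition R_bar :: "int \<Rightarrow> int \<Rightarrow> int \<Rightarrow> int \<Rightarrow> (int \<times> int \<Rightarrow> 'a::field) \<Rightarrow> int \<times> int \<Rightarrow> 'a" where
  "R_bar m n k j = local_R m n k n (\<lambda>i. (j, i)) (\<lambda>i. (j - 1, i)) (\<lambda>i. (j + 1, i))"

definition R_tilde :: "int \<Rightarrow> int \<Rightarrow> int \<Rightarrow> int \<Rightarrow> (int \<times> int \<Rightarrow> 'a::field) \<Rightarrow> int \<times> int \<Rightarrow> 'a" where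
  "R_tilde m n k i =
     (let N = gcd n k in
      local_R m n k (m * (n div N))
        (\<lambda>l. (m - l, N - i)) (\<lambda>l. (m - l, N - i + 1)) (\<lambda>l. (m - l, N - i - 1)))"

definition R_hat :: "int \<Rightarrow> int \<Rightarrow> int \<Rightarrow> int \<Rightarrow> (int \<times> int \<Rightarrow> 'a::field) \<Rightarrow> int \<times> int \<Rightarrow> 'a" where
  "R_hat m n k i =
     local_R m n k (m * n div gcd n (m + k))
       (\<lambda>j. (j, i + 1 - j)) (\<lambda>j. (j, i + 2 - j)) (\<lambda>j. (j, i - j))"


section \<open>Actions on the q-variables\<close>

text \<open>Vectors of length \<open>l\<close> are functions on \<open>{1..l}\<close>.\<close>

definition rot :: "int \<Rightarrow> int \<Rightarrow> (int \<Rightarrow> 'a) \<Rightarrow> int \<Rightarrow> 'a" where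
  "rot l i a = (\<lambda>h. a ((i + h - 1) mod l + 1))"

definition energy :: "int \<Rightarrow> (int \<Rightarrow> 'a::field) \<Rightarrow> (int \<Rightarrow> 'a) \<Rightarrow> 'a" where
  "energy l a b = (\<Sum>i\<in>{0..l - 1}. (\<Prod>h\<in>{1..i}. b h) * (\<Prod>h\<in>{i + 2..l}. a h))"

definition birational_R :: "int \<Rightarrow> (int \<Rightarrow> 'a::field) \<Rightarrow> (int \<Rightarrow> 'a) \<Rightarrow> (int \<Rightarrow> 'a) \<times> (int \<Rightarrow> 'a)" where
  "birational_R l a b =
     (let E = (\<lambda>i. energy l (rot l i a) (rot l i b))
      in (\<lambda>i. b i * E i / E (i - 1), \<lambda>i. a i * E (i - 1) / E i))"

text \<open>Replace the pair of vectors located at the positions \<open>p\<close> and \<open>p'\<close> by its image.\<close>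

definition act_R :: "int \<Rightarrow> int \<Rightarrow> int \<Rightarrow> int \<Rightarrow> (int \<Rightarrow> int \<times> int) \<Rightarrow> (int \<Rightarrow> int \<times> int) \<Rightarrow>
    (int \<times> int \<Rightarrow> 'a::field) \<Rightarrow> int \<times> int \<Rightarrow> 'a" where
  "act_R m n k l p p' q =
     (let (u, v) = birational_R l (\<lambda>i. q (p i)) (\<lambda>i. q (p' i))
      in put m n k {1..l} p u (put m n k {1..l} p' v q))"

definition row_shift :: "(int \<times> int \<Rightarrow> 'a) \<Rightarrow> int \<times> int \<Rightarrow> 'a" where
  "row_shift q = (\<lambda>(j, i). q (j + 1, i))"

definition col_shift :: "(int \<times> int \<Rightarrow> 'a) \<Rightarrow> int \<times> int \<Rightarrow> 'a" where
  "col_shift q = (\<lambda>(j, i). q (j, i - 1))"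

definition s_row :: "int \<Rightarrow> int \<Rightarrow> int \<Rightarrow> int \<Rightarrow> (int \<times> int \<Rightarrow> 'a::field) \<Rightarrow> int \<times> int \<Rightarrow> 'a" where
  "s_row m n k r = act_R m n k n (\<lambda>i. (r, i)) (\<lambda>i. (r + 1, i))"

definition s_act :: "int \<Rightarrow> int \<Rightarrow> int \<Rightarrow> int \<Rightarrow> (int \<times> int \<Rightarrow> 'a::field) \<Rightarrow> int \<times> int \<Rightarrow> 'a" where
  "s_act m n k r =
     (if r = 0 then row_shift \<circ> s_row m n k 1 \<circ> inv row_shift else s_row m n k r)"

definition s_col :: "int \<Rightarrow> int \<Rightarrow> int \<Rightarrow> int \<Rightarrow> (int \<times> int \<Rightarrow> 'a::field) \<Rightarrow> int \<times> int \<Rightarrow> 'a" where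
  "s_col m n k r =
     (let N = gcd n k;
          qt = (\<lambda>r l. (m + 1 - l, N + 1 - r))
      in act_R m n k (m * (n div N)) (qt r) (qt (r + 1)))"

definition s_tilde :: "int \<Rightarrow> int \<Rightarrow> int \<Rightarrow> int \<Rightarrow> (int \<times> int \<Rightarrow> 'a::field) \<Rightarrow> int \<times> int \<Rightarrow> 'a" where
  "s_tilde m n k r =
     (if r = 0 then col_shift \<circ> s_col m n k 1 \<circ> inv col_shift else s_col m n k r)"

definition snake :: "int \<Rightarrow> int \<Rightarrow> int \<Rightarrow> 'a::field \<Rightarrow> int \<Rightarrow> (int \<times> int \<Rightarrow> 'a) \<Rightarrow> int \<times> int \<Rightarrow> 'a" where
  "snake m n k c s q =
     (let M = gcd n (m + k) in
      (\<lambda>(j, i). q (j, i) * (if i mod M = (s - j + 1) mod M then c else 1)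
                         * (if i mod M = (s - j) mod M then inverse c else 1)))"


section \<open>The substitution rho and pullbacks\<close>

definition rho_point :: "int \<Rightarrow> int \<Rightarrow> int \<Rightarrow> int \<times> int \<Rightarrow> ratfun" where
  "rho_point m n k = (\<lambda>(j, i). generic m n k (j, i + 1) / generic m n k (j + 1, i))"

text \<open>
  \<open>substitutable_tuple \<sigma> F\<close> says that each component of \<open>F\<close> can be pulled back along the
  rational map with components \<open>\<sigma>\<close>, and \<open>pullback \<sigma> F\<close> is the tuple of these pullbacks.
\<close>

definition substitutable_tuple ::
    "(int \<times> int \<Rightarrow> ratfun) \<Rightarrow> (int \<times> int \<Rightarrow> ratfun) \<Rightarrow> bool" where
  "substitutable_tuple \<sigma> F \<longleftrightarrow> (\<forall>z. substitutable \<sigma> (F z))"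

definition pullback ::
    "(int \<times> int \<Rightarrow> ratfun) \<Rightarrow> (int \<times> int \<Rightarrow> ratfun) \<Rightarrow> int \<times> int \<Rightarrow> ratfun" where
  "pullback \<sigma> F = (\<lambda>z. rat_subst \<sigma> (F z))"

definition rho_defined :: "int \<Rightarrow> int \<Rightarrow> int \<Rightarrow> (int \<times> int \<Rightarrow> ratfun) \<Rightarrow> bool" where
  "rho_defined m n k F \<longleftrightarrow> substitutable_tuple (rho_point m n k) F"

definition rho :: "int \<Rightarrow> int \<Rightarrow> int \<Rightarrow> (int \<times> int \<Rightarrow> ratfun) \<Rightarrow> int \<times> int \<Rightarrow> ratfun" where
  "rho m n k F = pullback (rho_point m n k) F"

end

theory Submission
  imports Defs "HOL-Library.Product_Plus"
begin

text \<open>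
  Put \<open>S i = \<Sum>t<L. \<Prod>s=1..t. \<alpha> (i - s)\<close> and \<open>P = \<Prod>s=1..L. \<alpha> s\<close>.  Telescoping gives
  \<open>1 + \<omega> i = S (i + 1) / (1 - P)\<close>, so with \<open>f i = \<alpha> (i - 1) S (i - 1) / S i\<close> the local
  transformation multiplies \<open>\<alpha> i\<close>, \<open>\<beta> i\<close>, \<open>\<gamma> i\<close> by \<open>1 / (f i f (i + 1))\<close>, \<open>f i\<close>, \<open>f (i + 1)\<close>;
  the factor \<open>1 - P\<close> has cancelled.  Likewise the birational \<open>R\<close> multiplies \<open>a i\<close> and
  \<open>b i\<close> by \<open>\<phi> i = b i E i / (a i E (i - 1))\<close> and by \<open>1 / \<phi> i\<close>.  When \<open>\<alpha> i = a (i + 1) / b i\<close>, a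
  termwise comparison gives \<open>S i \<Prod>b = b i E i\<close>, hence \<open>f i = 1 / \<phi> i\<close>, and the rows and the
  columns are both instances of this one computation.  For the diagonals \<open>P\<close> becomes \<open>1\<close>, hence
  \<open>f = 1\<close>.  Nothing that occurs in a denominator vanishes identically, because it takes a
  positive value when all variables are set to \<open>1\<close>.
\<close>

section \<open>Substitution as a partial homomorphism\<close>

lemma rconst_add: "rconst (a + b) = rconst a + rconst b"
  by (simp add: rconst_def single_add)

lemma rconst_mult: "rconst (a * b) = rconst a * rconst b"
  by (simp add: rconst_def mult_single)

lemma rconst_0 [simp]: "rconst 0 = 0"
  by (simp add: rconst_def fract_collapse)

lemma rconst_1 [simp]: "rconst 1 = 1"
  by (simp add: rconst_def fract_collapse)

lemma rconst_inject [simp]: "rconst a = rconst b \<longleftrightarrow> a = b"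
proof
  assume "rconst a = rconst b"
  then have "(Poly_Mapping.single 0 a :: cpoly) = Poly_Mapping.single 0 b"
    by (simp add: rconst_def eq_fract)
  then show "a = b"
    by (metis lookup_single_eq)
qed simp

lemma rconst_inverse: "rconst (inverse a) = inverse (rconst a)"
proof (cases "a = 0")
  case False
  then have "rconst (inverse a) * rconst a = 1"
    by (simp flip: rconst_mult)
  then show ?thesis
    by (metis inverse_unique mult.commute)
qed simp

section \<open>Evaluation of polynomials as a ring homomorphism\<close>

definition mon_subst :: "(int \<times> int \<Rightarrow> ratfun) \<Rightarrow> ((int \<times> int) \<Rightarrow>\<^sub>0 nat) \<Rightarrow> ratfun" where
  "mon_subst \<sigma> a = (\<Prod>v\<in>Poly_Mapping.keys a. \<sigma> v ^ Poly_Mapping.lookup a v)"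

text \<open>Variables of exponent 0 contribute 1, so monomials with different supports can be
  evaluated over one common index set.\<close>

lemma mon_subst_superset:
  assumes "finite A" and "Poly_Mapping.keys a \<subseteq> A"
  shows "mon_subst \<sigma> a = (\<Prod>v\<in>A. \<sigma> v ^ Poly_Mapping.lookup a v)"
  unfolding mon_subst_def using assms
  by (intro prod.mono_neutral_left) (auto simp: in_keys_iff)

lemma mon_subst_add: "mon_subst \<sigma> (a + b) = mon_subst \<sigma> a * mon_subst \<sigma> b"
proof -
  let ?A = "Poly_Mapping.keys a \<union> Poly_Mapping.keys b"
  have "mon_subst \<sigma> c = (\<Prod>v\<in>?A. \<sigma> v ^ Poly_Mapping.lookup c v)" if "c \<in> {a, b, a + b}" for c
    using that Poly_Mapping.keys_add[of a b] by (intro mon_subst_superset) auto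
  then show ?thesis
    by (simp add: lookup_add power_add prod.distrib)
qed

lemma poly_subst_add: "poly_subst \<sigma> (P + Q) = poly_subst \<sigma> P + poly_subst \<sigma> Q"
  unfolding poly_subst_def
  by (rule setsum_keys_plus_distrib) (simp_all add: rconst_add distrib_right)

lemma poly_subst_single: "poly_subst \<sigma> (Poly_Mapping.single a c) = rconst c * mon_subst \<sigma> a"
  by (simp add: poly_subst_def mon_subst_def)

lemma poly_subst_const: "poly_subst \<sigma> (Poly_Mapping.single 0 c) = rconst c"
  by (simp add: poly_subst_single mon_subst_def)

lemma poly_subst_0 [simp]: "poly_subst \<sigma> 0 = 0"
  by (simp add: poly_subst_def)

lemma poly_subst_1 [simp]: "poly_subst \<sigma> 1 = 1"
  using poly_subst_const[of \<sigma> 1] by simp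

lemma poly_subst_var: "poly_subst \<sigma> (Poly_Mapping.single (Poly_Mapping.single v 1) 1) = \<sigma> v"
  by (simp add: poly_subst_single mon_subst_def)

text \<open>Setting a coefficient outside the support is adding one term. Used on both factors, this
  reduces multiplicativity of \<open>poly_subst\<close> to products of two terms.\<close>

lemma cpoly_induct [case_names zero add]:
  fixes P :: cpoly
  assumes "Q 0" and "\<And>a c P. Q P \<Longrightarrow> Q (Poly_Mapping.single a c + P)"
  shows "Q P"
proof (induction P rule: Poly_Mapping.update_induct)
  case const
  then show ?case using assms(1) by simp
next
  case (update f a b)
  then have "Poly_Mapping.update a b f = Poly_Mapping.single a b + f"
    by (intro poly_mapping_eqI) (auto simp: lookup_update lookup_add lookup_single in_keys_iff when_def)
  then show ?case using assms(2) update.IH by simp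
qed

lemma poly_subst_mult: "poly_subst \<sigma> (P * Q) = poly_subst \<sigma> P * poly_subst \<sigma> Q"
proof (induction P rule: cpoly_induct)
  case (add a c P)
  have "poly_subst \<sigma> (Poly_Mapping.single a c * Q) = rconst c * mon_subst \<sigma> a * poly_subst \<sigma> Q"
    by (induction Q rule: cpoly_induct)
      (simp_all add: distrib_left poly_subst_add mult_single poly_subst_single rconst_mult
        mon_subst_add mult_ac)
  with add show ?case
    by (simp add: distrib_right poly_subst_add poly_subst_single)
qed simp

section \<open>Substitution into rational functions\<close>

text \<open>The graph of \<open>rat_subst\<close> on its domain, so that each closure rule below
  yields definedness and value together.\<close>

definition substitutes_to :: "(int \<times> int \<Rightarrow> ratfun) \<Rightarrow> ratfun \<Rightarrow> ratfun \<Rightarrow> bool" where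
  "substitutes_to \<sigma> f g \<longleftrightarrow>
     (\<exists>P Q. f = Fract P Q \<and> poly_subst \<sigma> Q \<noteq> 0 \<and> g = poly_subst \<sigma> P / poly_subst \<sigma> Q)"

text \<open>A denominator that survives substitution is itself nonzero, since 0 is sent to 0;
  comparing fractions relies on this.\<close>

lemma substitutes_toE:
  assumes "substitutes_to \<sigma> f g"
  obtains P Q where "f = Fract P Q" "Q \<noteq> 0" "poly_subst \<sigma> Q \<noteq> 0"
    "g = poly_subst \<sigma> P / poly_subst \<sigma> Q"
  using assms unfolding substitutes_to_def by (metis poly_subst_0)

lemma substitutes_toI:
  assumes "f = Fract P Q" "poly_subst \<sigma> Q \<noteq> 0" "g = poly_subst \<sigma> P / poly_subst \<sigma> Q"
  shows "substitutes_to \<sigma> f g"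
  using assms unfolding substitutes_to_def by blast

text \<open>Equal fractions give a polynomial identity by cross-multiplication, and the homomorphism
  \<open>poly_subst\<close> preserves it.\<close>

lemma substitutes_to_unique:
  assumes "substitutes_to \<sigma> f g" and "substitutes_to \<sigma> f h"
  shows "g = h"
proof -
  obtain P Q where P: "f = Fract P Q" "Q \<noteq> 0" "poly_subst \<sigma> Q \<noteq> 0" "g = poly_subst \<sigma> P / poly_subst \<sigma> Q"
    using assms(1) by (rule substitutes_toE)
  obtain P' Q' where P': "f = Fract P' Q'" "Q' \<noteq> 0" "poly_subst \<sigma> Q' \<noteq> 0"
    "h = poly_subst \<sigma> P' / poly_subst \<sigma> Q'"
    using assms(2) by (rule substitutes_toE)
  have "P * Q' = P' * Q"
    using P P' by (simp add: eq_fract)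
  then have "poly_subst \<sigma> P * poly_subst \<sigma> Q' = poly_subst \<sigma> P' * poly_subst \<sigma> Q"
    by (metis poly_subst_mult)
  then show ?thesis
    using P P' by (simp add: frac_eq_eq)
qed

lemma rat_subst_eq:
  assumes "substitutes_to \<sigma> f g"
  shows "rat_subst \<sigma> f = g"
  unfolding rat_subst_def substitutes_to_def [symmetric]
  using assms by (blast intro: the_equality substitutes_to_unique)

lemma substitutes_to_imp_substitutable: "substitutes_to \<sigma> f g \<Longrightarrow> substitutable \<sigma> f"
  unfolding substitutes_to_def substitutable_def by blast

lemma substitutes_to_1 [intro]: "substitutes_to \<sigma> 1 1"
  by (rule substitutes_toI[of _ 1 1]) (simp_all add: fract_collapse)

lemma substitutes_to_0: "substitutes_to \<sigma> 0 0"
  by (rule substitutes_toI[of _ 0 1]) (simp_all add: fract_collapse)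

lemma substitutes_to_rvar: "substitutes_to \<sigma> (rvar v) (\<sigma> v)"
  by (rule substitutes_toI[OF rvar_def]) (use poly_subst_var[of \<sigma> v] in simp_all)

lemma substitutes_to_add:
  assumes "substitutes_to \<sigma> f g" and "substitutes_to \<sigma> f' g'"
  shows "substitutes_to \<sigma> (f + f') (g + g')"
proof -
  obtain P Q where P: "f = Fract P Q" "Q \<noteq> 0" "poly_subst \<sigma> Q \<noteq> 0" "g = poly_subst \<sigma> P / poly_subst \<sigma> Q"
    using assms(1) by (rule substitutes_toE)
  obtain P' Q' where P': "f' = Fract P' Q'" "Q' \<noteq> 0" "poly_subst \<sigma> Q' \<noteq> 0"
    "g' = poly_subst \<sigma> P' / poly_subst \<sigma> Q'"
    using assms(2) by (rule substitutes_toE)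
  show ?thesis
    using P P'
    by (intro substitutes_toI[of _ "P * Q' + P' * Q" "Q * Q'"])
      (simp_all add: poly_subst_mult poly_subst_add add_frac_eq)
qed

lemma substitutes_to_mult:
  assumes "substitutes_to \<sigma> f g" and "substitutes_to \<sigma> f' g'"
  shows "substitutes_to \<sigma> (f * f') (g * g')"
proof -
  obtain P Q where P: "f = Fract P Q" "Q \<noteq> 0" "poly_subst \<sigma> Q \<noteq> 0" "g = poly_subst \<sigma> P / poly_subst \<sigma> Q"
    using assms(1) by (rule substitutes_toE)
  obtain P' Q' where P': "f' = Fract P' Q'" "Q' \<noteq> 0" "poly_subst \<sigma> Q' \<noteq> 0"
    "g' = poly_subst \<sigma> P' / poly_subst \<sigma> Q'"
    using assms(2) by (rule substitutes_toE)
  show ?thesis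
    using P P'
    by (intro substitutes_toI[of _ "P * P'" "Q * Q'"]) (simp_all add: poly_subst_mult)
qed

text \<open>A nonzero value means that the numerator survives the substitution, so the reversed
  fraction is admissible.\<close>

lemma substitutes_to_inverse:
  assumes "substitutes_to \<sigma> f g" and "g \<noteq> 0"
  shows "substitutes_to \<sigma> (inverse f) (inverse g)"
proof -
  obtain P Q where P: "f = Fract P Q" "Q \<noteq> 0" "poly_subst \<sigma> Q \<noteq> 0" "g = poly_subst \<sigma> P / poly_subst \<sigma> Q"
    using assms(1) by (rule substitutes_toE)
  then show ?thesis
    using assms(2) by (intro substitutes_toI[of _ Q P]) simp_all
qed

lemma substitutes_to_divide:
  assumes "substitutes_to \<sigma> f g" and "substitutes_to \<sigma> f' g'" and "g' \<noteq> 0"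
  shows "substitutes_to \<sigma> (f / f') (g / g')"
  using assms by (simp add: divide_inverse substitutes_to_mult substitutes_to_inverse)

lemma substitutes_to_sum:
  assumes "\<And>i. i \<in> A \<Longrightarrow> substitutes_to \<sigma> (f i) (g i)"
  shows "substitutes_to \<sigma> (sum f A) (sum g A)"
  using assms
  by (induction A rule: infinite_finite_induct)
    (simp_all add: substitutes_to_0 substitutes_to_add)

lemma substitutes_to_prod:
  assumes "\<And>i. i \<in> A \<Longrightarrow> substitutes_to \<sigma> (f i) (g i)"
  shows "substitutes_to \<sigma> (prod f A) (prod g A)"
  using assms
  by (induction A rule: infinite_finite_induct)
    (simp_all add: substitutes_to_1 substitutes_to_mult)

section \<open>Nonvanishing by evaluation at the all-ones point\<close>

text \<open>Closed under sums, products and quotients, hence true of every subtraction-free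
  expression in the variables. The value is required to be a positive real so that sums cannot
  vanish.\<close>

definition positive_at_1 :: "ratfun \<Rightarrow> bool" where
  "positive_at_1 f \<longleftrightarrow> (\<exists>r>0. substitutes_to (\<lambda>_. 1) f (rconst (complex_of_real r)))"

lemma positive_at_1E:
  assumes "positive_at_1 f"
  obtains r where "r > 0" "substitutes_to (\<lambda>_. 1) f (rconst (complex_of_real r))"
  using assms unfolding positive_at_1_def by blast

lemma positive_at_1I:
  assumes "r > 0" and "substitutes_to (\<lambda>_. 1) f (rconst (complex_of_real r))"
  shows "positive_at_1 f"
  using assms unfolding positive_at_1_def by blast

lemma positive_at_1_nonzero:
  assumes "positive_at_1 f"
  shows "f \<noteq> 0"
proof
  assume "f = 0"
  obtain r where "r > 0" and r: "substitutes_to (\<lambda>_. 1) f (rconst (complex_of_real r))"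
    using assms by (rule positive_at_1E)
  have "rconst (complex_of_real r) = rconst 0"
    using substitutes_to_unique[OF r] substitutes_to_0 \<open>f = 0\<close> by simp
  with \<open>r > 0\<close> show False
    by (simp only: rconst_inject) simp
qed

lemma positive_at_1_1: "positive_at_1 1"
  by (rule positive_at_1I[of 1]) (simp_all add: substitutes_to_1)

lemma positive_at_1_rvar: "positive_at_1 (rvar v)"
  by (rule positive_at_1I[of 1]) (use substitutes_to_rvar[of "\<lambda>_. 1" v] in simp_all)

lemma positive_at_1_add:
  assumes "positive_at_1 f" and "positive_at_1 g"
  shows "positive_at_1 (f + g)"
proof -
  obtain r s where "r > 0" "s > 0" "substitutes_to (\<lambda>_. 1) f (rconst (complex_of_real r))"
    "substitutes_to (\<lambda>_. 1) g (rconst (complex_of_real s))"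
    using assms unfolding positive_at_1_def by blast
  then show ?thesis
    by (intro positive_at_1I[of "r + s"]) (simp_all add: rconst_add substitutes_to_add)
qed

lemma positive_at_1_mult:
  assumes "positive_at_1 f" and "positive_at_1 g"
  shows "positive_at_1 (f * g)"
proof -
  obtain r s where "r > 0" "s > 0" "substitutes_to (\<lambda>_. 1) f (rconst (complex_of_real r))"
    "substitutes_to (\<lambda>_. 1) g (rconst (complex_of_real s))"
    using assms unfolding positive_at_1_def by blast
  then show ?thesis
    by (intro positive_at_1I[of "r * s"]) (simp_all add: rconst_mult substitutes_to_mult)
qed

lemma positive_at_1_inverse:
  assumes "positive_at_1 f"
  shows "positive_at_1 (inverse f)"
proof -
  obtain r where r: "r > 0" "substitutes_to (\<lambda>_. 1) f (rconst (complex_of_real r))"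
    using assms by (rule positive_at_1E)
  moreover have "rconst (complex_of_real r) \<noteq> 0"
    using r(1) rconst_inject[of "complex_of_real r" 0] by simp
  ultimately show ?thesis
    by (intro positive_at_1I[of "inverse r"]) (simp_all add: rconst_inverse substitutes_to_inverse)
qed

lemma positive_at_1_divide: "positive_at_1 f \<Longrightarrow> positive_at_1 g \<Longrightarrow> positive_at_1 (f / g)"
  by (simp add: divide_inverse positive_at_1_mult positive_at_1_inverse)

lemma positive_at_1_sum:
  assumes "finite A" and "A \<noteq> {}" and "\<And>i. i \<in> A \<Longrightarrow> positive_at_1 (f i)"
  shows "positive_at_1 (sum f A)"
  using assms by (induction A rule: finite_ne_induct) (simp_all add: positive_at_1_add)

lemma positive_at_1_prod:
  assumes "\<And>i. i \<in> A \<Longrightarrow> positive_at_1 (f i)"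
  shows "positive_at_1 (prod f A)"
  using assms
  by (induction A rule: infinite_finite_induct) (simp_all add: positive_at_1_1 positive_at_1_mult)


section \<open>Path sums and energies\<close>

definition periodic :: "int \<Rightarrow> (int \<Rightarrow> 'a) \<Rightarrow> bool" where
  "periodic L f \<longleftrightarrow> (\<forall>i. f (i + L) = f i)"

lemma periodic_shift_mult:
  assumes "periodic L f"
  shows "f (i + L * t) = f i"
proof (induction t rule: int_induct[where k = 0])
  case (step1 t)
  then show ?case
    using assms by (metis (no_types) periodic_def add.assoc distrib_left mult.right_neutral)
next
  case (step2 t)
  have "f (i + L * (t - 1)) = f (i + L * (t - 1) + L)"
    using assms by (simp add: periodic_def)
  also have "i + L * (t - 1) + L = i + L * t"
    by (simp add: algebra_simps)
  finally show ?case using step2 by simp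
qed simp

lemma periodicI: "(\<And>i. f (i + L) = f i) \<Longrightarrow> periodic L f"
  by (simp add: periodic_def)

lemma periodic_add: "periodic L f \<Longrightarrow> f (i + L + h) = f (i + h)"
  unfolding periodic_def by (metis add.assoc add.commute)

lemma periodic_diff: "periodic L f \<Longrightarrow> f (i + L - h) = f (i - h)"
  using periodic_add[of L f i "- h"] by simp

lemma periodic_eq:
  assumes "periodic L f" and "L dvd i - j"
  shows "f i = f j"
proof -
  obtain t where "i = j + L * t"
    using assms(2) by (metis dvdE add.commute diff_add_cancel)
  then show ?thesis
    using periodic_shift_mult[OF assms(1)] by simp
qed

lemma periodic_mod:
  assumes "periodic L f"
  shows "f ((i - 1) mod L + 1) = f i"
proof (rule periodic_eq[OF assms])
  have "(i - 1) mod L + 1 - i = - (L * ((i - 1) div L))"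
    by (simp add: minus_mult_div_eq_mod [symmetric])
  then show "L dvd (i - 1) mod L + 1 - i"
    by simp
qed

text \<open>Sliding the window by one drops \<open>f j\<close> and gains \<open>f (j + L)\<close>,
  which are equal; induction in both directions leads to the window starting at 1.\<close>

lemma prod_period:
  fixes f :: "int \<Rightarrow> 'a::comm_monoid_mult"
  assumes "periodic L f" and "L > 0"
  shows "(\<Prod>h\<in>{i..<i + L}. f h) = (\<Prod>h\<in>{1..L}. f h)"
proof -
  have step: "(\<Prod>h\<in>{j..<j + L}. f h) = (\<Prod>h\<in>{j + 1..<j + 1 + L}. f h)" for j
  proof -
    have "{j..<j + L} = insert j {j + 1..<j + L}" "{j + 1..<j + 1 + L} = insert (j + L) {j + 1..<j + L}"
      using assms(2) by auto
    then show ?thesis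
      using assms(1) by (simp add: periodic_def)
  qed
  have "(\<Prod>h\<in>{i..<i + L}. f h) = (\<Prod>h\<in>{1..<1 + L}. f h)"
  proof (induction i rule: int_induct[where k = 1])
    case (step1 i)
    then show ?case using step[of i] by simp
  next
    case (step2 i)
    then show ?case using step[of "i - 1"] by simp
  qed simp
  moreover have "{1..<1 + L} = {1..L}"
    by auto
  ultimately show ?thesis by simp
qed

lemma prod_backwards:
  fixes f :: "int \<Rightarrow> 'a::comm_monoid_mult"
  shows "(\<Prod>s\<in>{1..t}. f (i - s)) = (\<Prod>h\<in>{i - t..<i}. f h)"
  by (rule prod.reindex_bij_witness[of _ "\<lambda>h. i - h" "\<lambda>s. i - s"]) auto

lemma prod_shift:
  fixes f :: "int \<Rightarrow> 'a::comm_monoid_mult"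
  shows "(\<Prod>h\<in>{s..t}. f (i + h)) = (\<Prod>h\<in>{i + s..<i + t + 1}. f h)"
  by (rule prod.reindex_bij_witness[of _ "\<lambda>h. h - i" "\<lambda>h. i + h"]) auto

lemma prod_concat:
  fixes f :: "int \<Rightarrow> 'a::comm_monoid_mult"
  assumes "a \<le> b" and "b \<le> c"
  shows "(\<Prod>h\<in>{a..<b}. f h) * (\<Prod>h\<in>{b..<c}. f h) = (\<Prod>h\<in>{a..<c}. f h)"
proof -
  have "{a..<c} = {a..<b} \<union> {b..<c}"
    using assms by auto
  then show ?thesis
    by (simp add: prod.union_disjoint)
qed

section \<open>Path sums and omega\<close>

definition path_sum :: "int \<Rightarrow> (int \<Rightarrow> 'a::field) \<Rightarrow> int \<Rightarrow> 'a" where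
  "path_sum L \<alpha> i = (\<Sum>t\<in>{0..L - 1}. \<Prod>s\<in>{1..t}. \<alpha> (i - s))"

text \<open>The factor acquired by the neighbouring rows, written without \<open>1 - P\<close>; it
  stays meaningful when substitution sends \<open>P\<close> to 1.\<close>

definition path_ratio :: "int \<Rightarrow> (int \<Rightarrow> 'a::field) \<Rightarrow> int \<Rightarrow> 'a" where
  "path_ratio L \<alpha> i = \<alpha> (i - 1) * path_sum L \<alpha> (i - 1) / path_sum L \<alpha> i"

lemma omega_path_sum: "omega L \<alpha> i = \<alpha> i * path_sum L \<alpha> i / (1 - (\<Prod>s\<in>{1..L}. \<alpha> s))"
  by (simp add: omega_def path_sum_def)

text \<open>With \<open>T t\<close> the product of the \<open>t\<close> entries ending at
  \<open>i\<close>, the left side is \<open>T 0 + ... + T (L - 1)\<close>, while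
  \<open>\<alpha> i\<close> times the path sum at \<open>i\<close> is
  \<open>T 1 + ... + T L\<close>. They differ only by \<open>T 0 = 1\<close> and the full period
  \<open>T L\<close>.\<close>

lemma path_sum_Suc:
  fixes \<alpha> :: "int \<Rightarrow> 'a::field"
  assumes "periodic L \<alpha>" and "L > 0"
  shows "path_sum L \<alpha> (i + 1) = 1 - (\<Prod>s\<in>{1..L}. \<alpha> s) + \<alpha> i * path_sum L \<alpha> i"
proof -
  define T where "T t = (\<Prod>h\<in>{i + 1 - t..<i + 1}. \<alpha> h)" for t
  have "\<alpha> i * (\<Prod>h\<in>{i - t..<i}. \<alpha> h) = T (t + 1)" if "t \<ge> 0" for t
  proof -
    have "{i + 1 - (t + 1)..<i + 1} = insert i {i - t..<i}"
      using that by auto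
    then show ?thesis by (simp add: T_def)
  qed
  then have "\<alpha> i * path_sum L \<alpha> i = (\<Sum>t\<in>{0..L - 1}. T (t + 1))"
    by (simp add: path_sum_def prod_backwards sum_distrib_left)
  also have "\<dots> = (\<Sum>t\<in>{1..L}. T t)"
    by (rule sum.reindex_bij_witness[of _ "\<lambda>t. t - 1" "\<lambda>t. t + 1"]) auto
  also have "\<dots> = (\<Sum>t\<in>{1..L - 1}. T t) + T L"
  proof -
    have "{1..L} = insert L {1..L - 1}"
      using assms(2) by auto
    then show ?thesis by (simp add: add.commute)
  qed
  also have "T L = (\<Prod>s\<in>{1..L}. \<alpha> s)"
    using prod_period[OF assms, of "i + 1 - L"] by (simp add: T_def)
  finally have 1: "\<alpha> i * path_sum L \<alpha> i = (\<Sum>t\<in>{1..L - 1}. T t) + (\<Prod>s\<in>{1..L}. \<alpha> s)" .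
  have "{0..L - 1} = insert 0 {1..L - 1}"
    using assms(2) by auto
  then have "path_sum L \<alpha> (i + 1) = T 0 + (\<Sum>t\<in>{1..L - 1}. T t)"
    by (simp add: path_sum_def prod_backwards T_def)
  with 1 show ?thesis
    by (simp add: T_def)
qed

lemma periodic_path_sum:
  assumes "periodic L \<alpha>"
  shows "periodic L (path_sum L \<alpha>)"
  by (rule periodicI) (simp add: path_sum_def periodic_diff[OF assms])

lemma periodic_path_ratio:
  assumes "periodic L \<alpha>"
  shows "periodic L (path_ratio L \<alpha>)"
  using periodic_path_sum[OF assms] assms
  by (intro periodicI) (simp add: path_ratio_def periodic_diff, simp add: periodic_def)

text \<open>For period product 1 the recurrence loses its inhomogeneous term, so numerator and
  denominator of the ratio coincide.\<close>

lemma path_ratio_eq_1: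
  assumes "periodic L \<alpha>" and "L > 0" and "(\<Prod>s\<in>{1..L}. \<alpha> s) = 1" and "path_sum L \<alpha> i \<noteq> 0"
  shows "path_ratio L \<alpha> i = 1"
  using path_sum_Suc[OF assms(1,2), of "i - 1"] assms(3,4) by (simp add: path_ratio_def)

context
  fixes L :: int and \<alpha> :: "int \<Rightarrow> 'a::field"
  assumes per: "periodic L \<alpha>" and L: "L > 0"
    and P: "(\<Prod>s\<in>{1..L}. \<alpha> s) \<noteq> 1"
    and nz: "\<And>i. \<alpha> i \<noteq> 0" "\<And>i. path_sum L \<alpha> i \<noteq> 0"
begin

lemma one_plus_omega: "1 + omega L \<alpha> i = path_sum L \<alpha> (i + 1) / (1 - (\<Prod>s\<in>{1..L}. \<alpha> s))"
  using P by (simp add: omega_path_sum path_sum_Suc[OF per L] add_divide_distrib)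

lemma omega_factor: "inverse (1 + inverse (omega L \<alpha> i)) = path_ratio L \<alpha> (i + 1)"
proof -
  have "omega L \<alpha> i \<noteq> 0"
    using nz P by (simp add: omega_path_sum)
  \<comment> \<open>In this form numerator and denominator share \<open>1 - P\<close>, which
    cancels.\<close>
  then have "inverse (1 + inverse (omega L \<alpha> i)) = omega L \<alpha> i / (1 + omega L \<alpha> i)"
    by (simp add: field_simps)
  then show ?thesis
    using P unfolding one_plus_omega by (simp add: omega_path_sum path_ratio_def)
qed

text \<open>In the product of two consecutive ratios the path sum at \<open>i\<close> cancels,
  leaving those at \<open>i - 1\<close> and \<open>i + 1\<close>.\<close>

lemma omega_center:
  "inverse (omega L \<alpha> (i - 1)) * (1 + omega L \<alpha> i) =
     \<alpha> i / (path_ratio L \<alpha> i * path_ratio L \<alpha> (i + 1))"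
  using P nz unfolding one_plus_omega by (simp add: omega_path_sum path_ratio_def field_simps)

end

section \<open>Energies and the birational R\<close>

text \<open>Rotating a vector is translating its periodic extension, which removes the modular
  indices.\<close>

lemma energy_rot:
  fixes a b :: "int \<Rightarrow> 'a::field"
  assumes "periodic L a" and "periodic L b"
  shows "energy L (rot L i a) (rot L i b) = energy L (\<lambda>h. a (i + h)) (\<lambda>h. b (i + h))"
  using assms by (simp add: rot_def periodic_mod)

lemma periodic_energy:
  fixes a b :: "int \<Rightarrow> 'a::field"
  assumes "periodic L a" and "periodic L b"
  shows "periodic L (\<lambda>i. energy L (\<lambda>h. a (i + h)) (\<lambda>h. b (i + h)))"
  by (rule periodicI) (simp add: periodic_add[OF assms(1)] periodic_add[OF assms(2)])

text \<open>The full period product of \<open>b\<close> absorbs the \<open>t\<close> denominators of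
  term \<open>t\<close> and leaves the entries from \<open>i\<close> to
  \<open>i + L - 1 - t\<close>. So term \<open>t\<close> becomes \<open>b i\<close> times the energy
  term of index \<open>L - 1 - t\<close>.\<close>

lemma path_sum_energy:
  fixes a b :: "int \<Rightarrow> 'a::field"
  assumes "periodic L a" and "periodic L b" and "L > 0" and "\<And>i. b i \<noteq> 0"
  shows "path_sum L (\<lambda>i. a (i + 1) / b i) i * (\<Prod>h\<in>{1..L}. b h) =
           b i * energy L (\<lambda>h. a (i + h)) (\<lambda>h. b (i + h))"
proof -
  have term_eq: "(\<Prod>s\<in>{1..t}. a (i - s + 1) / b (i - s)) * (\<Prod>h\<in>{1..L}. b h) =
      b i * ((\<Prod>h\<in>{1..L - 1 - t}. b (i + h)) * (\<Prod>h\<in>{L - 1 - t + 2..L}. a (i + h)))"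
    if "t \<in> {0..L - 1}" for t
  proof -
    \<comment> \<open>The indices from \<open>i - t + 1\<close> to \<open>i\<close> move forward by
      one period.\<close>
    have a: "(\<Prod>s\<in>{1..t}. a (i - s + 1)) = (\<Prod>h\<in>{L - 1 - t + 2..L}. a (i + h))"
    proof (rule prod.reindex_bij_witness[of _ "\<lambda>h. L + 1 - h" "\<lambda>s. L + 1 - s"])
      fix s
      show "a (i + (L + 1 - s)) = a (i - s + 1)"
        by (rule periodic_eq[OF assms(1)]) (simp add: algebra_simps)
    qed auto
    have "b i * (\<Prod>h\<in>{1..L - 1 - t}. b (i + h)) = (\<Prod>h\<in>{i..<i + L - t}. b h)"
    proof -
      have "{i..<i + L - t} = insert i {i + 1..<i + (L - 1 - t) + 1}"
        using that by auto
      then show ?thesis by (simp add: prod_shift)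
    qed
    \<comment> \<open>The denominators followed by the surviving factors fill one period, starting
      at \<open>i - t\<close>.\<close>
    moreover have "(\<Prod>s\<in>{1..t}. b (i - s)) * (\<Prod>h\<in>{i..<i + L - t}. b h) = (\<Prod>h\<in>{i - t..<i - t + L}. b h)"
      unfolding prod_backwards using that by (subst prod_concat) (auto simp: algebra_simps)
    ultimately have b: "(\<Prod>h\<in>{1..L}. b h) =
        (\<Prod>s\<in>{1..t}. b (i - s)) * (b i * (\<Prod>h\<in>{1..L - 1 - t}. b (i + h)))"
      using prod_period[OF assms(2,3)] by simp
    have "(\<Prod>s\<in>{1..t}. b (i - s)) \<noteq> 0"
      using assms(4) by simp
    then show ?thesis
      unfolding b by (simp add: prod_dividef a)
  qed
  have "path_sum L (\<lambda>i. a (i + 1) / b i) i * (\<Prod>h\<in>{1..L}. b h) =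
      (\<Sum>t\<in>{0..L - 1}. b i * ((\<Prod>h\<in>{1..L - 1 - t}. b (i + h)) * (\<Prod>h\<in>{L - 1 - t + 2..L}. a (i + h))))"
    unfolding path_sum_def sum_distrib_right by (rule sum.cong[OF refl term_eq])
  also have "\<dots> = b i * energy L (\<lambda>h. a (i + h)) (\<lambda>h. b (i + h))"
    unfolding energy_def sum_distrib_left
    by (rule sum.reindex_bij_witness[of _ "\<lambda>t. L - 1 - t" "\<lambda>t. L - 1 - t"]) auto
  finally show ?thesis .
qed

text \<open>Dividing the new entry \<open>b i * E i / E (i - 1)\<close> by the old entry
  \<open>a i\<close> turns the exchange of two rows into a rescaling of each row in place.\<close>

definition exchange_factor :: "int \<Rightarrow> (int \<Rightarrow> 'a::field) \<Rightarrow> (int \<Rightarrow> 'a) \<Rightarrow> int \<Rightarrow> 'a" where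
  "exchange_factor L a b i =
     b i * energy L (\<lambda>h. a (i + h)) (\<lambda>h. b (i + h)) /
       (a i * energy L (\<lambda>h. a (i - 1 + h)) (\<lambda>h. b (i - 1 + h)))"

text \<open>The path sum at \<open>i\<close> is \<open>b i * E i / B\<close> with the same
  \<open>B\<close> for all \<open>i\<close>, so \<open>B\<close> cancels, and
  \<open>b (i - 1)\<close> cancels against the denominator of
  \<open>a i / b (i - 1)\<close>.\<close>

lemma path_ratio_exchange_factor:
  fixes a b :: "int \<Rightarrow> 'a::field"
  assumes "periodic L a" and "periodic L b" and "L > 0" and nz: "\<And>i. b i \<noteq> 0"
  shows "path_ratio L (\<lambda>i. a (i + 1) / b i) i = inverse (exchange_factor L a b i)"
proof -
  define B where "B = (\<Prod>h\<in>{1..L}. b h)"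
  have "B \<noteq> 0"
    using nz by (simp add: B_def)
  moreover have "path_sum L (\<lambda>i. a (i + 1) / b i) i =
      b i * energy L (\<lambda>h. a (i + h)) (\<lambda>h. b (i + h)) / B" for i
    using path_sum_energy[OF assms, of i] \<open>B \<noteq> 0\<close> by (simp add: B_def nonzero_eq_divide_eq)
  ultimately show ?thesis
    using nz by (simp add: path_ratio_def exchange_factor_def)
qed

lemma periodic_exchange_factor:
  fixes a b :: "int \<Rightarrow> 'a::field"
  assumes "periodic L a" and "periodic L b"
  shows "periodic L (exchange_factor L a b)"
proof -
  define E where "E i = energy L (\<lambda>h. a (i + h)) (\<lambda>h. b (i + h))" for i
  have "periodic L E"
    using periodic_energy[OF assms] by (simp add: E_def [abs_def])
  then have "E (i + L) = E i" "E (i + L - 1) = E (i - 1)" for i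
    by (simp_all add: periodic_diff, simp add: periodic_def)
  then show ?thesis
    using assms unfolding exchange_factor_def E_def [symmetric] by (simp add: periodic_def)
qed

lemma birational_R_eq:
  fixes a b :: "int \<Rightarrow> 'a::field"
  assumes "periodic L a" and "periodic L b" and "\<And>i. a i \<noteq> 0" and "\<And>i. b i \<noteq> 0"
  shows "birational_R L a b =
    (\<lambda>i. a i * exchange_factor L a b i, \<lambda>i. b i * inverse (exchange_factor L a b i))"
  using assms(3,4)
  by (simp add: birational_R_def Let_def energy_rot[OF assms(1,2)] exchange_factor_def fun_eq_iff)


section \<open>Closed strips on the torus\<close>

locale torus =
  fixes m n k :: int
  assumes m_pos: "m > 0" and n_pos: "n > 0"
begin

abbreviation r :: "int \<times> int \<Rightarrow> int \<times> int" where
  "r \<equiv> rep m n k"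

text \<open>Positions are identified modulo the lattice generated by \<open>(m, k)\<close> and
  \<open>(0, n)\<close>. The row residue yields \<open>t\<close>; moving \<open>t\<close> blocks of
  \<open>m\<close> rows changes the quotient by \<open>t\<close>, hence the column by
  \<open>k * t\<close>.\<close>

lemma rep_eq_iff: "r z = r z' \<longleftrightarrow> (\<exists>t s. z' = z + (m * t, k * t + n * s))"
proof -
  obtain j i j' i' where z: "z = (j, i)" "z' = (j', i')"
    by (metis surj_pair)
  have row: "(j - 1) mod m = (j' - 1) mod m \<longleftrightarrow> (\<exists>t. j' = j + m * t)"
  proof -
    have "(j - 1) mod m = (j' - 1) mod m \<longleftrightarrow> m dvd (j' - 1) - (j - 1)"
      by (metis mod_eq_dvd_iff)
    also have "\<dots> \<longleftrightarrow> (\<exists>t. j' = j + m * t)"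
      unfolding dvd_def by (auto simp: algebra_simps)
    finally show ?thesis .
  qed
  have col: "(i - k * ((j - 1) div m) - 1) mod n = (i' - k * ((j' - 1) div m) - 1) mod n \<longleftrightarrow>
      (\<exists>s. i' = i + k * t + n * s)" if "j' = j + m * t" for t
  proof -
    have "(j' - 1) div m = (j - 1) div m + t"
      using that m_pos div_mult_self2[of m "j - 1" t] by (simp add: algebra_simps)
    then have "(i - k * ((j - 1) div m) - 1) mod n = (i' - k * ((j' - 1) div m) - 1) mod n \<longleftrightarrow>
        n dvd i' - (i + k * t)"
      by (subst eq_commute) (simp add: mod_eq_dvd_iff algebra_simps)
    also have "\<dots> \<longleftrightarrow> (\<exists>s. i' = i + k * t + n * s)"
      unfolding dvd_def by (auto simp: algebra_simps)
    finally show ?thesis .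
  qed
  have "r z = r z' \<longleftrightarrow> (j - 1) mod m = (j' - 1) mod m \<and>
      (i - k * ((j - 1) div m) - 1) mod n = (i' - k * ((j' - 1) div m) - 1) mod n"
    by (simp add: z rep_def)
  also have "\<dots> \<longleftrightarrow> (\<exists>t. j' = j + m * t \<and> (\<exists>s. i' = i + k * t + n * s))"
    using row col by blast
  also have "\<dots> \<longleftrightarrow> (\<exists>t s. z' = z + (m * t, k * t + n * s))"
    by (simp add: z add.assoc)
  finally show ?thesis .
qed

lemma rep_add_cancel [simp]: "r (z + w) = r (z' + w) \<longleftrightarrow> r z = r z'"
proof -
  have "z' + w = z + w + v \<longleftrightarrow> z' = z + v" for v
    by (metis add.assoc add.commute add_right_cancel)
  then show ?thesis
    by (simp add: rep_eq_iff)
qed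

lemma rep_diff_cancel [simp]: "r (z - w) = r (z' - w) \<longleftrightarrow> r z = r z'"
  using rep_add_cancel[of z "- w" z'] by simp

lemma rep_rep [simp]: "r (r z) = r z"
  by (cases z) (simp add: rep_def)

definition invariant :: "(int \<times> int \<Rightarrow> 'a) \<Rightarrow> bool" where
  "invariant x \<longleftrightarrow> (\<forall>z z'. r z = r z' \<longrightarrow> x z = x z')"

lemma invariantD: "invariant x \<Longrightarrow> r z = r z' \<Longrightarrow> x z = x z'"
  unfolding invariant_def by blast

lemma invariant_generic: "invariant (generic m n k)"
  by (simp add: invariant_def generic_def)

lemma invariant_rho_point: "invariant (rho_point m n k)"
  unfolding invariant_def rho_point_def
proof (clarsimp)
  fix j i j' i' assume eq: "r (j, i) = r (j', i')"
  have "r (j, i + 1) = r (j', i' + 1)" "r (j + 1, i) = r (j' + 1, i')"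
    using eq rep_add_cancel[of "(j, i)" "(0, 1)" "(j', i')"]
      rep_add_cancel[of "(j, i)" "(1, 0)" "(j', i')"] by simp_all
  then show "generic m n k (j, i + 1) / generic m n k (j + 1, i) =
      generic m n k (j', i' + 1) / generic m n k (j' + 1, i')"
    by (simp add: generic_def)
qed

text \<open>A generic entry is the variable of a representative; invariance carries its value back
  to \<open>z\<close>.\<close>

lemma substitutes_to_generic:
  assumes "invariant \<sigma>"
  shows "substitutes_to \<sigma> (generic m n k z) (\<sigma> z)"
  using substitutes_to_rvar[of \<sigma> "r z"] invariantD[OF assms, of "r z" z]
  by (simp add: generic_def)

lemma positive_generic: "positive_at_1 (generic m n k z)"
  by (simp add: generic_def positive_at_1_rvar)

lemma positive_rho_point: "positive_at_1 (rho_point m n k z)"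
  by (cases z) (simp add: rho_point_def positive_at_1_divide positive_generic)

lemma rho_generic: "rho m n k (generic m n k) = rho_point m n k"
  by (simp add: rho_def pullback_def fun_eq_iff
      rat_subst_eq[OF substitutes_to_generic[OF invariant_rho_point]])

text \<open>Evaluates the pullbacks for the R actions and the snake action alike: each coordinate of
  \<open>rho\<close> is a quotient of two generic coordinates.\<close>

lemma pullback_rho:
  assumes "invariant \<sigma>" and "\<And>z. \<sigma> z \<noteq> 0"
  shows "substitutable_tuple \<sigma> (rho m n k (generic m n k))"
    and "pullback \<sigma> (rho m n k (generic m n k)) = (\<lambda>z. \<sigma> (z + (0, 1)) / \<sigma> (z + (1, 0)))"
proof -
  have *: "substitutes_to \<sigma> (rho_point m n k z) (\<sigma> (z + (0, 1)) / \<sigma> (z + (1, 0)))" for z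
    using assms by (cases z)
      (auto simp: rho_point_def intro!: substitutes_to_divide substitutes_to_generic)
  show "substitutable_tuple \<sigma> (rho m n k (generic m n k))"
    using * by (auto simp: substitutable_tuple_def rho_generic intro: substitutes_to_imp_substitutable)
  show "pullback \<sigma> (rho m n k (generic m n k)) = (\<lambda>z. \<sigma> (z + (0, 1)) / \<sigma> (z + (1, 0)))"
    using rat_subst_eq[OF *] by (simp add: pullback_def rho_generic)
qed

text \<open>Conjugating an update by a translation only moves its positions; this serves the index 0
  actions, defined by conjugation with shifts.\<close>

lemma put_translate:
  "put m n k A p v (\<lambda>z. x (z - w)) (z + w) = put m n k A (\<lambda>l. p l - w) v x z"
proof -
  have "r (p l) = r (z + w) \<longleftrightarrow> r (p l - w) = r z" for l
    using rep_add_cancel[of "p l - w" w z] by simp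
  then show ?thesis
    by (simp add: put_def)
qed

lemma act_R_translate:
  "act_R m n k l p p' (\<lambda>z. q (z - w)) (z + w) = act_R m n k l (\<lambda>i. p i - w) (\<lambda>i. p' i - w) q z"
proof -
  have "put m n k A p' v (\<lambda>z. q (z - w)) = (\<lambda>z. put m n k A (\<lambda>l. p' l - w) v q (z - w))" for A v
    using put_translate[of A p' v q w "_ - w"] by (simp add: fun_eq_iff)
  then show ?thesis
    by (simp add: act_R_def put_translate split_beta Let_def)
qed

end

text \<open>\<open>d\<close> steps along the strip, \<open>e\<close> leads across it. The strip
  closes up after exactly \<open>L\<close> steps and does not meet its translate by
  \<open>e\<close>. Rows, columns and diagonals become instances.\<close>

locale strip = torus +
  fixes L :: int and p :: "int \<Rightarrow> int \<times> int" and d e :: "int \<times> int"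
  assumes L_pos: "L > 0"
    and p_Suc: "p (l + 1) = p l + d"
    and rep_p: "rep m n k (p l) = rep m n k (p l') \<longleftrightarrow> L dvd l - l'"
    and rep_e: "rep m n k (p l + e) \<noteq> rep m n k (p l')"
begin

text \<open>Extending a sequence by 1 off the strip makes row updates pointwise products on the
  torus. For periodic \<open>v\<close> the index picked by \<open>SOME\<close> does not affect the
  value.\<close>

definition along :: "(int \<Rightarrow> 'a::one) \<Rightarrow> int \<times> int \<Rightarrow> 'a" where
  "along v z = (if \<exists>l. r (p l) = r z then v (SOME l. r (p l) = r z) else 1)"

lemma along_hit:
  assumes "periodic L v" and "r (p l) = r z"
  shows "along v z = v l"
proof -
  let ?l = "SOME l. r (p l) = r z"
  have "r (p ?l) = r z"
    using assms(2) by (rule someI)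
  then have "L dvd ?l - l"
    using assms(2) by (simp flip: rep_p)
  then show ?thesis
    using assms periodic_eq[OF assms(1)] by (auto simp: along_def)
qed

lemma along_miss: "(\<And>l. r (p l) \<noteq> r z) \<Longrightarrow> along v z = 1"
  by (simp add: along_def)

lemma invariant_along: "invariant (along v)"
  by (simp add: invariant_def along_def)

lemma along_inverse: "along (\<lambda>l. inverse (v l)) z = inverse (along v z :: 'a::field)"
  by (simp add: along_def)

lemma along_one: "along (\<lambda>_. 1) z = 1"
  by (simp add: along_def)

lemma along_nonzero:
  fixes v :: "int \<Rightarrow> 'a::field"
  shows "(\<And>l. v l \<noteq> 0) \<Longrightarrow> along v z \<noteq> 0"
  by (simp add: along_def)

lemma periodic_along_p:
  assumes "invariant x"
  shows "periodic L (\<lambda>l. x (p l + w))"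
  by (intro periodicI invariantD[OF assms]) (simp add: rep_p)

text \<open>Complete residue systems modulo \<open>L\<close>, covering both the range
  \<open>{0..<L}\<close> of \<open>local_R\<close> and the range \<open>{1..L}\<close> of
  \<open>act_R\<close>.\<close>

definition complete :: "int set \<Rightarrow> bool" where
  "complete A \<longleftrightarrow> (\<forall>l. \<exists>!l'. l' \<in> A \<and> L dvd l' - l)"

lemma complete_atLeastLessThan: "complete {a..<a + L}"
  unfolding complete_def
proof (intro allI ex1I conjI)
  fix l l'
  show "a + (l - a) mod L \<in> {a..<a + L}"
    using L_pos by simp
  have "a + (l - a) mod L - l = - (L * ((l - a) div L))"
    by (simp add: minus_mult_div_eq_mod [symmetric])
  then show "L dvd a + (l - a) mod L - l"
    by simp
  assume l': "l' \<in> {a..<a + L} \<and> L dvd l' - l"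
  then have "(l' - a) mod L = (l - a) mod L"
    unfolding mod_eq_dvd_iff by simp
  moreover have "(l' - a) mod L = l' - a"
    using l' by (intro mod_pos_pos_trivial) auto
  ultimately show "l' = a + (l - a) mod L"
    by simp
qed

text \<open>Each position of the row is hit by exactly one index in \<open>A\<close>, which
  determines the description in \<open>put\<close>; off the row both sides leave \<open>x\<close>
  unchanged.\<close>

lemma put_row:
  fixes x :: "int \<times> int \<Rightarrow> 'a::monoid_mult"
  assumes "complete A" and "periodic L v" and "invariant x"
  shows "put m n k A (\<lambda>l. p l + w) (\<lambda>l. x (p l + w) * v l) x z = x z * along v (z - w)"
proof (cases "\<exists>l. r (p l) = r (z - w)")
  case True
  have shift: "r (p l + w) = r z \<longleftrightarrow> r (p l) = r (z - w)" for l
    using rep_add_cancel[of "p l" w "z - w"] by simp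
  obtain l where l: "r (p l) = r (z - w)"
    using True by blast
  have "\<exists>!l'. l' \<in> A \<and> r (p l' + w) = r z"
    using assms(1) l rep_p[of _ l] unfolding complete_def shift by simp
  then have "(THE l'. l' \<in> A \<and> r (p l' + w) = r z) \<in> A \<and>
      r (p (THE l'. l' \<in> A \<and> r (p l' + w) = r z) + w) = r z" (is "?l \<in> A \<and> _")
    by (rule theI')
  then have "?l \<in> A" "r (p ?l + w) = r z"
    by blast+
  moreover from this have "along v (z - w) = v ?l" "x (p ?l + w) = x z"
    using along_hit[OF assms(2)] invariantD[OF assms(3)] shift by blast+
  ultimately show ?thesis
    by (auto simp: put_def)
next
  case False
  then have "r (p l + w) \<noteq> r z" for l
    using rep_add_cancel[of "p l" w "z - w"] by simp
  then show ?thesis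
    using False by (simp add: put_def along_miss)
qed

lemma invariant_times_along:
  fixes x :: "int \<times> int \<Rightarrow> 'a::monoid_mult"
  assumes "invariant x"
  shows "invariant (\<lambda>z. x z * along v (z + w))"
  using assms invariant_along[of v] unfolding invariant_def by (metis rep_add_cancel)

text \<open>Advancing the index advances the position by \<open>d\<close>. If \<open>z\<close> is
  off the strip then so is \<open>z + d\<close>, because the strip is closed under stepping
  back.\<close>

lemma along_shift:
  assumes "periodic L v"
  shows "along (\<lambda>l. v (l + 1)) z = along v (z + d)"
proof (cases "\<exists>l. r (p l) = r z")
  case True
  then obtain l where l: "r (p l) = r z" by blast
  then have "r (p (l + 1)) = r (z + d)"
    by (simp add: p_Suc)
  moreover have "periodic L (\<lambda>l. v (l + 1))"
    using periodic_add[OF assms, of _ 1] by (intro periodicI) simp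
  ultimately show ?thesis
    using along_hit l assms by metis
next
  case False
  have "r (p l) \<noteq> r (z + d)" for l
  proof
    assume "r (p l) = r (z + d)"
    then have "r (p (l - 1) + d) = r (z + d)"
      using p_Suc[of "l - 1"] by simp
    with False show False by simp
  qed
  then show ?thesis
    using False by (simp add: along_miss)
qed

text \<open>The translate by \<open>- e\<close> avoids the strip too: adding \<open>e\<close> to a
  coincidence contradicts \<open>rep_e\<close>.\<close>

lemma along_neighbour:
  assumes "r (p l) = r z"
  shows "along v (z + e) = 1" and "along v (z - e) = 1"
proof (safe intro!: along_miss)
  fix l' assume "r (p l') = r (z + e)"
  moreover have "r (z + e) = r (p l + e)"
    using assms by simp
  ultimately show False
    using rep_e[of l l'] by simp
next
  fix l' assume "r (p l') = r (z - e)"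
  then have "r (p l' + e) = r (z - e + e)"
    by (simp only: rep_add_cancel)
  then show False
    using rep_e[of l' l] assms by simp
qed

text \<open>
  Stated multiplicatively, the update covers the case in which the rows \<open>p - e\<close> and \<open>p + e\<close>
  coincide.
\<close>

lemma local_R_eq:
  fixes x :: "int \<times> int \<Rightarrow> 'a::field"
  assumes x: "invariant x" and nz: "\<And>z. x z \<noteq> 0"
    and P: "(\<Prod>l\<in>{1..L}. x (p l)) \<noteq> 1"
    and S: "\<And>i. path_sum L (\<lambda>l. x (p l)) i \<noteq> 0"
  defines "V \<equiv> along (path_ratio L (\<lambda>l. x (p l)))"
  shows "local_R m n k L p (\<lambda>l. p l - e) (\<lambda>l. p l + e) x z =
           x z * V (z + e) * V (z - e + d) / (V z * V (z + d))"
proof -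
  define \<alpha> where "\<alpha> = (\<lambda>l. x (p l))"
  define f where "f = path_ratio L \<alpha>"
  have per: "periodic L \<alpha>"
    using periodic_along_p[OF x, of 0] by (simp add: \<alpha>_def)
  then have f: "periodic L f"
    by (simp add: f_def periodic_path_ratio)
  then have f': "periodic L (\<lambda>l. f (l + 1))"
    using periodic_add[OF f, of _ 1] by (intro periodicI) simp
  have facts: "inverse (1 + inverse (omega L \<alpha> i)) = f (i + 1)"
    "inverse (omega L \<alpha> (i - 1)) * (1 + omega L \<alpha> i) = \<alpha> i / (f i * f (i + 1))" for i
    using omega_factor[OF per L_pos] omega_center[OF per L_pos] P S nz
    by (simp_all add: \<alpha>_def f_def)
  \<comment> \<open>\<open>y\<close> and \<open>y'\<close> are the arrays after the first and the
    second neighbour update. The second uses \<open>f (l + 1)\<close>, hence the extra shift by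
    \<open>d\<close>.\<close>
  define y where "y = (\<lambda>z. x z * along f (z + e))"
  define y' where "y' = (\<lambda>z. y z * along f (z + (d - e)))"
  have inv_y: "invariant y" and inv_y': "invariant y'"
    unfolding y_def y'_def using x by (simp_all only: invariant_times_along)
  have C: "complete {0..<L}"
    using complete_atLeastLessThan[of 0] by simp
  have 1: "put m n k {0..<L} (\<lambda>l. p l - e) (\<lambda>l. x (p l - e) * f l) x = y"
    using put_row[OF C f x, of "- e"] by (simp add: y_def fun_eq_iff)
  have 2: "put m n k {0..<L} (\<lambda>l. p l + e) (\<lambda>l. y (p l + e) * f (l + 1)) y = y'"
    using put_row[OF C f' inv_y, of e] along_shift[OF f]
    by (simp add: y'_def fun_eq_iff algebra_simps)
  define h where "h l = inverse (f l * f (l + 1))" for l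
  have h: "periodic L h"
    using f f' by (simp add: h_def periodic_def)
  \<comment> \<open>Neither neighbour update touches the strip, so
    \<open>y' (p l) = \<alpha> l\<close> and the central update is multiplicative as well.\<close>
  have "\<alpha> l / (f l * f (l + 1)) = y' (p l) * h l" for l
    using along_neighbour[of l "p l" f] along_neighbour[of l "p l" "\<lambda>l. f (l + 1)"] along_shift[OF f, of "p l - e"]
    by (simp add: y'_def y_def h_def \<alpha>_def divide_inverse algebra_simps)
  then have "local_R m n k L p (\<lambda>l. p l - e) (\<lambda>l. p l + e) x = put m n k {0..<L} p (\<lambda>l. y' (p l) * h l) y'"
    using 1 2 facts(1)[of "_ - 1"] facts unfolding local_R_def Let_def \<alpha>_def [symmetric] by simp
  then have "local_R m n k L p (\<lambda>l. p l - e) (\<lambda>l. p l + e) x z = y' z * along h z"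
    using put_row[OF C h inv_y', of 0] by simp
  also have "along h z = inverse (along f z * along f (z + d))"
  proof -
    have "along h z = inverse (along f z * along (\<lambda>l. f (l + 1)) z)"
      by (simp add: along_def h_def)
    then show ?thesis
      by (simp only: along_shift[OF f])
  qed
  finally show ?thesis
    by (simp add: V_def f_def \<alpha>_def y'_def y_def divide_inverse algebra_simps)
qed

text \<open>The two rows are disjoint by \<open>rep_e\<close>, so the replacements are independent
  rescalings by the exchange factor and its inverse.\<close>

lemma act_R_eq:
  fixes q :: "int \<times> int \<Rightarrow> 'a::field" and w :: "int \<times> int"
  assumes q: "invariant q" and nz: "\<And>z. q z \<noteq> 0"
  defines "U \<equiv> along (exchange_factor L (\<lambda>l. q (p l + w)) (\<lambda>l. q (p l + w + e)))"
  shows "act_R m n k L (\<lambda>l. p l + w) (\<lambda>l. p l + w + e) q z = q z * U (z - w) / U (z - w - e)"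
proof -
  define f where "f = exchange_factor L (\<lambda>l. q (p l + w)) (\<lambda>l. q (p l + w + e))"
  have per: "periodic L (\<lambda>l. q (p l + w))" "periodic L (\<lambda>l. q (p l + w + e))"
    using periodic_along_p[OF q, of w] periodic_along_p[OF q, of "w + e"] by (simp_all add: add.assoc)
  then have f: "periodic L f"
    by (simp add: f_def periodic_exchange_factor)
  then have f': "periodic L (\<lambda>l. inverse (f l))"
    by (simp add: periodic_def)
  have C: "complete {1..L}"
    using complete_atLeastLessThan[of 1] by (simp add: atLeastLessThanPlusOne_atLeastAtMost_int add.commute[of 1])
  define y where "y = (\<lambda>z. q z * along (\<lambda>l. inverse (f l)) (z + - (w + e)))"
  have y: "invariant y"
    unfolding y_def using q by (rule invariant_times_along)
  have 1: "put m n k {1..L} (\<lambda>l. p l + w + e) (\<lambda>l. q (p l + w + e) * inverse (f l)) q = y"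
    using put_row[OF C f' q, of "w + e"]
    by (simp only: y_def fun_eq_iff add.assoc diff_conv_add_uminus) blast
  \<comment> \<open>The inner update leaves the first row alone, so the outer \<open>put\<close>
    multiplies original entries.\<close>
  have y_p: "y (p l + w) = q (p l + w)" for l
    using along_neighbour(2)[of l "p l" "\<lambda>l. inverse (f l)"] by (simp add: y_def algebra_simps)
  have "act_R m n k L (\<lambda>l. p l + w) (\<lambda>l. p l + w + e) q z =
      put m n k {1..L} (\<lambda>l. p l + w) (\<lambda>l. y (p l + w) * f l) y z"
    using 1 unfolding y_p
    by (simp add: act_R_def birational_R_eq[OF per nz nz] f_def)
  also have "\<dots> = y z * along f (z - w)"
    by (rule put_row[OF C f y])
  also have "\<dots> = q z * U (z - w) / U (z - w - e)"
    by (simp add: y_def along_inverse U_def f_def divide_inverse algebra_simps)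
  finally show ?thesis .
qed

section \<open>Pulling the local transformation back along rho\<close>

lemma positive_path_ratio:
  assumes "\<And>i. positive_at_1 (\<alpha> i)"
  shows "positive_at_1 (path_sum L \<alpha> i)" and "positive_at_1 (path_ratio L \<alpha> i)"
  using assms L_pos unfolding path_ratio_def path_sum_def
  by (auto intro!: positive_at_1_divide positive_at_1_mult positive_at_1_sum positive_at_1_prod)

lemma positive_exchange_factor:
  assumes "\<And>i. positive_at_1 (a i)" and "\<And>i. positive_at_1 (b i)"
  shows "positive_at_1 (exchange_factor L a b i)"
  using assms L_pos unfolding exchange_factor_def energy_def
  by (auto intro!: positive_at_1_divide positive_at_1_mult positive_at_1_sum positive_at_1_prod)

text \<open>At the generic point the period product is not 1, so the cancelled form of
  \<open>local_R\<close> is available; it substitutes termwise because the path ratios stay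
  nonzero.\<close>

lemma substitutes_to_local_R:
  defines "V \<equiv> along (path_ratio L (\<lambda>l. rho_point m n k (p l)))"
  shows "substitutes_to (rho_point m n k)
           (local_R m n k L p (\<lambda>l. p l - e) (\<lambda>l. p l + e) (generic m n k) z)
           (rho_point m n k z * V (z + e) * V (z - e + d) / (V z * V (z + d)))"
proof -
  let ?x = "generic m n k" and ?\<rho> = "rho_point m n k"
  note nonzero = positive_at_1_nonzero
  have x: "substitutes_to ?\<rho> (?x z) (?\<rho> z)" for z
    by (rule substitutes_to_generic[OF invariant_rho_point])
  have path_sum: "substitutes_to ?\<rho> (path_sum L (\<lambda>l. ?x (p l)) i) (path_sum L (\<lambda>l. ?\<rho> (p l)) i)" for i
    unfolding path_sum_def by (intro substitutes_to_sum substitutes_to_prod x)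
  have path_ratio: "substitutes_to ?\<rho> (path_ratio L (\<lambda>l. ?x (p l)) i) (path_ratio L (\<lambda>l. ?\<rho> (p l)) i)" for i
    unfolding path_ratio_def
    by (intro substitutes_to_divide substitutes_to_mult x path_sum nonzero
        positive_path_ratio positive_rho_point)
  have V: "substitutes_to ?\<rho> (along (path_ratio L (\<lambda>l. ?x (p l))) z) (V z)" for z
    using path_ratio by (auto simp: V_def along_def)
  have V_nz: "V z \<noteq> 0" for z
    unfolding V_def by (intro along_nonzero nonzero positive_path_ratio positive_rho_point)
  \<comment> \<open>Setting all variables to 0 sends this nonempty product to 0 but fixes 1.\<close>
  have "(\<Prod>l\<in>{1..L}. ?x (p l)) \<noteq> 1"
  proof
    assume eq: "(\<Prod>l\<in>{1..L}. ?x (p l)) = 1"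
    have "substitutes_to (\<lambda>_. 0) (\<Prod>l\<in>{1..L}. ?x (p l)) (\<Prod>l\<in>{1..L}. 0)"
      by (intro substitutes_to_prod substitutes_to_generic) (simp add: invariant_def)
    then have "(\<Prod>l\<in>{1..L}. 0) = (1::ratfun)"
      unfolding eq using substitutes_to_1 by (rule substitutes_to_unique)
    then show False
      using L_pos by (simp add: zero_power)
  qed
  then have "local_R m n k L p (\<lambda>l. p l - e) (\<lambda>l. p l + e) ?x z =
      ?x z * along (path_ratio L (\<lambda>l. ?x (p l))) (z + e) *
        along (path_ratio L (\<lambda>l. ?x (p l))) (z - e + d) /
      (along (path_ratio L (\<lambda>l. ?x (p l))) z * along (path_ratio L (\<lambda>l. ?x (p l))) (z + d))"
    by (intro local_R_eq invariant_generic nonzero positive_generic positive_path_ratio)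
  then show ?thesis
    by (simp only:) (intro substitutes_to_divide substitutes_to_mult x V, simp add: V_nz)
qed

lemma rho_local_R:
  defines "V \<equiv> along (path_ratio L (\<lambda>l. rho_point m n k (p l)))"
  shows "rho_defined m n k (local_R m n k L p (\<lambda>l. p l - e) (\<lambda>l. p l + e) (generic m n k))"
    and "rho m n k (local_R m n k L p (\<lambda>l. p l - e) (\<lambda>l. p l + e) (generic m n k)) =
      (\<lambda>z. rho_point m n k z * V (z + e) * V (z - e + d) / (V z * V (z + d)))"
  using substitutes_to_local_R[folded V_def]
  by (auto simp: rho_defined_def substitutable_tuple_def rho_def pullback_def fun_eq_iff
      intro: substitutes_to_imp_substitutable rat_subst_eq)

text \<open>
  The vector \<open>w\<close> is the offset between the face row and the first of the two rows of
  \<open>q\<close>-variables bounding it.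
\<close>

lemma intertwine:
  fixes w :: "int \<times> int"
  assumes w: "w + d = (0, 1)" "w + e = (1, 0)"
  defines "Q \<equiv> act_R m n k L (\<lambda>l. p l + w) (\<lambda>l. p l + w + e) (generic m n k)"
  shows "substitutable_tuple Q (rho m n k (generic m n k))"
    and "rho m n k (local_R m n k L p (\<lambda>l. p l - e) (\<lambda>l. p l + e) (generic m n k)) =
      pullback Q (rho m n k (generic m n k))"
proof -
  let ?q = "generic m n k" and ?\<rho> = "rho_point m n k"
  have rho: "?\<rho> z = ?q (z + (w + d)) / ?q (z + (w + e))" for z
    unfolding w by (cases z) (simp add: rho_point_def)
  define a where "a l = ?q (p l + w)" for l
  define b where "b l = ?q (p l + w + e)" for l
  define U where "U = along (exchange_factor L a b)"
  have U_nz: "U z \<noteq> 0" for z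
    unfolding U_def a_def b_def
    by (intro along_nonzero positive_at_1_nonzero positive_exchange_factor positive_generic)
  have q_nz: "?q z \<noteq> 0" for z
    by (intro positive_at_1_nonzero positive_generic)
  have per: "periodic L a" "periodic L b"
    using periodic_along_p[OF invariant_generic, of w] periodic_along_p[OF invariant_generic, of "w + e"]
    by (simp_all add: a_def [abs_def] b_def [abs_def] add.assoc)
  have Q: "Q z = ?q z * U (z - w) / U (z - w - e)" for z
    unfolding Q_def U_def a_def b_def by (rule act_R_eq[OF invariant_generic q_nz])
  have Q_nz: "Q z \<noteq> 0" for z
    by (simp add: Q q_nz U_nz)
  have Q_inv: "invariant Q"
    unfolding invariant_def
  proof (intro allI impI)
    fix z z' assume "r z = r z'"
    then have "?q z = ?q z'" "U (z - w) = U (z' - w)" "U (z - w - e) = U (z' - w - e)"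
      unfolding U_def by (auto intro: invariantD[OF invariant_generic] invariantD[OF invariant_along])
    then show "Q z = Q z'" by (simp add: Q)
  qed
  note pull = pullback_rho[OF Q_inv Q_nz]
  show "substitutable_tuple Q (rho m n k ?q)"
    by (rule pull)
  \<comment> \<open>As \<open>p l + d = p (l + 1)\<close>, the numerator lies one step further on
    the first row and the denominator on the second row at step \<open>l\<close>.\<close>
  have "(\<lambda>l. ?\<rho> (p l)) = (\<lambda>l. a (l + 1) / b l)"
    by (simp add: rho a_def b_def p_Suc add.commute add.left_commute)
  then have "path_ratio L (\<lambda>l. ?\<rho> (p l)) = (\<lambda>l. inverse (exchange_factor L a b l))"
    using path_ratio_exchange_factor[OF per L_pos] q_nz by (simp add: fun_eq_iff b_def)
  then have V: "along (path_ratio L (\<lambda>l. ?\<rho> (p l))) z = inverse (U z)" for z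
    by (simp add: U_def along_inverse)
  \<comment> \<open>The numerator contributes \<open>U (z + d) / U (z + d - e)\<close> and the
    denominator \<open>U (z + e) / U z\<close>, matching the four path ratios.\<close>
  have "Q (z + (0, 1)) / Q (z + (1, 0)) =
      ?\<rho> z * inverse (U (z + e)) * inverse (U (z - e + d)) / (inverse (U z) * inverse (U (z + d)))" for z
  proof -
    have "z + (w + d) - w = z + d" "z + (w + d) - w - e = z + d - e"
      "z + (w + e) - w = z + e" "z + (w + e) - w - e = z"
      by (simp_all add: algebra_simps)
    moreover have swap: "z - e + d = z + d - e"
      by (simp add: algebra_simps)
    ultimately show ?thesis
      using U_nz q_nz unfolding w [symmetric] Q rho swap by (simp add: divide_inverse mult_ac)
  qed
  then show "rho m n k (local_R m n k L p (\<lambda>l. p l - e) (\<lambda>l. p l + e) ?q) = pullback Q (rho m n k ?q)"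
    unfolding rho_local_R V pull(2) by simp
qed

lemma rho_local_R_trivial:
  assumes "(\<Prod>l\<in>{1..L}. rho_point m n k (p l)) = 1"
  shows "rho m n k (local_R m n k L p (\<lambda>l. p l - e) (\<lambda>l. p l + e) (generic m n k)) =
    rho m n k (generic m n k)"
proof -
  have "periodic L (\<lambda>l. rho_point m n k (p l))"
    using periodic_along_p[OF invariant_rho_point, of 0] by simp
  then have "path_ratio L (\<lambda>l. rho_point m n k (p l)) = (\<lambda>_. 1)"
    using L_pos assms
    by (auto intro!: path_ratio_eq_1 positive_at_1_nonzero positive_path_ratio positive_rho_point)
  then show ?thesis
    by (simp add: rho_local_R along_one rho_generic)
qed

end


section \<open>Rows, columns and diagonals\<close>

context torus
begin

section \<open>Uniform formulas including index 0\<close>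

text \<open>Conjugation by the row shift carries rows 1 and 2 to rows 0 and 1.\<close>

lemma s_act_eq:
  fixes q :: "int \<times> int \<Rightarrow> 'a::field"
  shows "s_act m n k j q = act_R m n k n (\<lambda>i. (j, i)) (\<lambda>i. (j + 1, i)) q"
proof (cases "j = 0")
  case True
  have shift: "row_shift = (\<lambda>(q::int \<times> int \<Rightarrow> 'a) z. q (z + (1, 0)))"
    by (auto simp: row_shift_def fun_eq_iff)
  have "inv row_shift = (\<lambda>(q::int \<times> int \<Rightarrow> 'a) z. q (z - (1, 0)))"
    by (rule inv_equality) (simp_all add: shift)
  then have "s_act m n k 0 q = row_shift (s_row m n k 1 (\<lambda>z. q (z - (1, 0))))"
    by (simp only: s_act_def o_apply if_True simp_thms)
  then show ?thesis
    using True act_R_translate[of n "\<lambda>i. (1, i)" "\<lambda>i. (2, i)" q "(1, 0)"]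
    unfolding shift s_row_def by simp
qed (simp add: s_act_def s_row_def)

text \<open>With \<open>N = gcd n k\<close>, conjugation by the column shift carries columns
  \<open>N\<close> and \<open>N - 1\<close> to \<open>N + 1\<close> and \<open>N\<close>.\<close>

lemma s_tilde_eq:
  fixes q :: "int \<times> int \<Rightarrow> 'a::field"
  shows "s_tilde m n k i q = act_R m n k (m * (n div gcd n k))
     (\<lambda>l. (m + 1 - l, gcd n k + 1 - i)) (\<lambda>l. (m + 1 - l, gcd n k - i)) q"
proof (cases "i = 0")
  case True
  have shift: "col_shift = (\<lambda>(q::int \<times> int \<Rightarrow> 'a) z. q (z + (0, - 1)))"
    by (auto simp: col_shift_def fun_eq_iff)
  have "inv col_shift = (\<lambda>(q::int \<times> int \<Rightarrow> 'a) z. q (z - (0, - 1)))"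
    by (rule inv_equality) (simp_all add: shift)
  then have "s_tilde m n k 0 q = col_shift (s_col m n k 1 (\<lambda>z. q (z - (0, - 1))))"
    by (simp only: s_tilde_def o_apply if_True simp_thms)
  then show ?thesis
    using True act_R_translate[of "m * (n div gcd n k)" "\<lambda>l. (m + 1 - l, gcd n k)"
        "\<lambda>l. (m + 1 - l, gcd n k - 1)" q "(0, - 1)"]
    unfolding shift s_col_def Let_def by simp
next
  case False
  then show ?thesis
    by (simp add: s_tilde_def s_col_def Let_def algebra_simps)
qed

section \<open>Closing lengths and disjointness of neighbouring strips\<close>

lemma dvd_cofactor_iff: "n div gcd n c dvd t \<longleftrightarrow> n dvd c * t" for c t :: int
proof -
  let ?g = "gcd n c"
  have g: "?g \<noteq> 0" using n_pos by simp
  have "n dvd c * t \<longleftrightarrow> ?g * (n div ?g) dvd ?g * ((c div ?g) * t)"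
    by (metis dvd_mult_div_cancel gcd_dvd1 gcd_dvd2 mult.assoc)
  also have "\<dots> \<longleftrightarrow> n div ?g dvd (c div ?g) * t"
    unfolding dvd_mult_cancel_left using g by blast
  also have "\<dots> \<longleftrightarrow> n div ?g dvd t"
    using g by (intro coprime_dvd_mult_right_iff div_gcd_coprime) simp
  finally show ?thesis by blast
qed

text \<open>Passing \<open>m\<close> rows \<open>t\<close> times shifts the column by
  \<open>c * t\<close> modulo \<open>n\<close>, so a line closes when \<open>n div gcd n c\<close>
  divides \<open>t\<close>. Columns use \<open>c = k\<close>, diagonals
  \<open>c = m + k\<close>.\<close>

lemma cofactor_period:
  fixes c a :: int
  shows "(\<exists>t s. a = m * t \<and> c * t + n * s = 0) \<longleftrightarrow> m * (n div gcd n c) dvd a"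
proof -
  have "(\<exists>s. c * t + n * s = 0) \<longleftrightarrow> n dvd c * t" for t
  proof
    assume "\<exists>s. c * t + n * s = 0"
    then obtain s where "c * t = n * (- s)"
      by (auto simp: eq_neg_iff_add_eq_0)
    then show "n dvd c * t" by simp
  next
    assume "n dvd c * t"
    then obtain u where "c * t = n * u" by (rule dvdE)
    then have "c * t + n * (- u) = 0" by simp
    then show "\<exists>s. c * t + n * s = 0" by blast
  qed
  then have "(\<exists>t s. a = m * t \<and> c * t + n * s = 0) \<longleftrightarrow> (\<exists>t. a = m * t \<and> n div gcd n c dvd t)"
    by (simp add: dvd_cofactor_iff)
  also have "\<dots> \<longleftrightarrow> m * (n div gcd n c) dvd a"
    using m_pos by (auto simp: dvd_def mult.assoc)
  finally show ?thesis .
qed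

lemma cofactor_pos: "m * (n div gcd n c) > 0" for c :: int
  using m_pos n_pos by (simp add: pos_imp_zdiv_pos_iff zdvd_imp_le)

text \<open>Adjacent rows could be identified only if \<open>m\<close> divided 1.\<close>

lemma strip_bar:
  assumes "m \<ge> 2"
  shows "strip m n k n (\<lambda>l. (j, l)) (0, 1) (1, 0)"
proof unfold_locales
  fix l l'
  have "r (j, l) = r (j, l') \<longleftrightarrow> (\<exists>s. l' = l + n * s)"
    using m_pos by (auto simp: rep_eq_iff)
  also have "\<dots> \<longleftrightarrow> n dvd l' - l"
    by (auto simp: dvd_def algebra_simps)
  finally show "r (j, l) = r (j, l') \<longleftrightarrow> n dvd l - l'"
    by (simp only: dvd_diff_commute)
  show "r ((j, l) + (1, 0)) \<noteq> r (j, l')"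
  proof
    assume "r ((j, l) + (1, 0)) = r (j, l')"
    then obtain t where "1 + m * t = 0"
      by (auto simp: rep_eq_iff)
    then have "1 = m * (- t)"
      by simp
    then have "m dvd 1"
      by (rule dvdI)
    then show False
      using assms by simp
  qed
qed (use n_pos in auto)

text \<open>Adjacent columns could meet only if 1 were an integer combination of \<open>k\<close>
  and \<open>n\<close>, hence a multiple of their gcd.\<close>

lemma strip_tilde:
  assumes "gcd n k \<ge> 2"
  shows "strip m n k (m * (n div gcd n k)) (\<lambda>l. (m - l, i)) (- 1, 0) (0, - 1)"
proof unfold_locales
  fix l l'
  have "r (m - l, i) = r (m - l', i) \<longleftrightarrow> (\<exists>t s. l - l' = m * t \<and> k * t + n * s = 0)"
    by (auto simp: rep_eq_iff algebra_simps)
  then show "r (m - l, i) = r (m - l', i) \<longleftrightarrow> m * (n div gcd n k) dvd l - l'"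
    by (simp only: cofactor_period)
  show "r ((m - l, i) + (0, - 1)) \<noteq> r (m - l', i)"
  proof
    assume "r ((m - l, i) + (0, - 1)) = r (m - l', i)"
    then obtain t s where eq: "1 = k * t + n * s"
      by (auto simp: rep_eq_iff)
    have "gcd n k dvd 1"
      unfolding eq by simp
    then show False
      using assms by simp
  qed
qed (use cofactor_pos in auto)

text \<open>On a diagonal the column falls as the row rises, so \<open>m\<close> rows shift it by
  \<open>m + k\<close> relative to the lattice instead of \<open>k\<close>.\<close>

lemma strip_hat:
  assumes "gcd n (m + k) \<ge> 2"
  shows "strip m n k (m * (n div gcd n (m + k))) (\<lambda>l. (l, i - l)) (1, - 1) (0, - 1)"
proof unfold_locales
  fix l l'
  have "r (l, i - l) = r (l', i - l') \<longleftrightarrow> (\<exists>t s. l' - l = m * t \<and> (m + k) * t + n * s = 0)"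
    unfolding rep_eq_iff by (intro ex_cong1) (auto simp: algebra_simps)
  then show "r (l, i - l) = r (l', i - l') \<longleftrightarrow> m * (n div gcd n (m + k)) dvd l - l'"
    by (simp only: cofactor_period dvd_diff_commute)
  show "r ((l, i - l) + (0, - 1)) \<noteq> r (l', i - l')"
  proof
    assume "r ((l, i - l) + (0, - 1)) = r (l', i - l')"
    then obtain t s where eq: "1 = (m + k) * t + n * s"
      by (auto simp: rep_eq_iff algebra_simps)
    have "gcd n (m + k) dvd 1"
      unfolding eq by simp
    then show False
      using assms by simp
  qed
qed (use cofactor_pos in auto)

section \<open>The three kinds of transformation and the snake action\<close>

lemma R_bar_intertwine:
  assumes "m \<ge> 2"
  shows "rho_defined m n k (R_bar m n k j (generic m n k))"
    and "substitutable_tuple (s_act m n k j (generic m n k)) (rho m n k (generic m n k))"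
    and "rho m n k (R_bar m n k j (generic m n k)) =
      pullback (s_act m n k j (generic m n k)) (rho m n k (generic m n k))"
proof -
  interpret strip m n k n "\<lambda>l. (j, l)" "(0, 1)" "(1, 0)"
    using assms by (rule strip_bar)
  show "rho_defined m n k (R_bar m n k j (generic m n k))"
    using rho_local_R(1) by (simp add: R_bar_def)
  show "substitutable_tuple (s_act m n k j (generic m n k)) (rho m n k (generic m n k))"
    "rho m n k (R_bar m n k j (generic m n k)) =
      pullback (s_act m n k j (generic m n k)) (rho m n k (generic m n k))"
    using intertwine[of "(0, 0)"] by (simp_all add: R_bar_def s_act_eq)
qed

lemma R_tilde_intertwine:
  assumes "gcd n k \<ge> 2"
  shows "rho_defined m n k (R_tilde m n k i (generic m n k))"
    and "substitutable_tuple (s_tilde m n k i (generic m n k)) (rho m n k (generic m n k))"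
    and "rho m n k (R_tilde m n k i (generic m n k)) =
      pullback (s_tilde m n k i (generic m n k)) (rho m n k (generic m n k))"
proof -
  interpret strip m n k "m * (n div gcd n k)" "\<lambda>l. (m - l, gcd n k - i)" "(- 1, 0)" "(0, - 1)"
    using assms by (rule strip_tilde)
  \<comment> \<open>The offset \<open>(1, 1)\<close> takes the face column to the first of the two
    columns exchanged by \<open>s_tilde\<close>.\<close>
  have p: "(\<lambda>l. (m - l, gcd n k - i) + (1, 1)) = (\<lambda>l. (m + 1 - l, gcd n k + 1 - i))"
    "(\<lambda>l. (m - l, gcd n k - i) + (1, 1) + (0, - 1)) = (\<lambda>l. (m + 1 - l, gcd n k - i))"
    by (auto simp: fun_eq_iff)
  show "rho_defined m n k (R_tilde m n k i (generic m n k))"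
    using rho_local_R(1) by (simp add: R_tilde_def Let_def)
  show "substitutable_tuple (s_tilde m n k i (generic m n k)) (rho m n k (generic m n k))"
    using intertwine(1)[of "(1, 1)"] unfolding p s_tilde_eq by simp
  show "rho m n k (R_tilde m n k i (generic m n k)) =
      pullback (s_tilde m n k i (generic m n k)) (rho m n k (generic m n k))"
    using intertwine(2)[of "(1, 1)"] unfolding p s_tilde_eq by (simp add: R_tilde_def Let_def)
qed

text \<open>On a diagonal, rho gives the quotients \<open>g l / g (l + 1)\<close> of one cyclic
  sequence, whose product over a period is 1.\<close>

lemma R_hat_trivial:
  assumes "gcd n (m + k) \<ge> 2"
  shows "rho_defined m n k (R_hat m n k i (generic m n k))"
    and "rho m n k (R_hat m n k i (generic m n k)) = rho m n k (generic m n k)"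
proof -
  let ?L = "m * (n div gcd n (m + k))" and ?q = "generic m n k"
  interpret strip m n k ?L "\<lambda>l. (l, i + 1 - l)" "(1, - 1)" "(0, - 1)"
    using assms by (rule strip_hat)
  have L: "m * n div gcd n (m + k) = ?L"
    by (simp add: div_mult_swap)
  have R: "R_hat m n k i ?q =
      local_R m n k ?L (\<lambda>l. (l, i + 1 - l)) (\<lambda>l. (l, i + 1 - l) - (0, - 1))
        (\<lambda>l. (l, i + 1 - l) + (0, - 1)) ?q"
    unfolding R_hat_def L by (simp add: algebra_simps)
  show "rho_defined m n k (R_hat m n k i ?q)"
    unfolding R by (rule rho_local_R)
  define g where "g l = ?q (l, i + 2 - l)" for l
  have g_nz: "g l \<noteq> 0" for l
    unfolding g_def by (intro positive_at_1_nonzero positive_generic)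
  have g: "periodic ?L g"
    using periodic_along_p[OF invariant_generic, of "(0, 1)"] by (simp add: g_def [abs_def] algebra_simps)
  have "(\<Prod>l\<in>{1..?L}. rho_point m n k (l, i + 1 - l)) = (\<Prod>l\<in>{1..?L}. g l) / (\<Prod>l\<in>{1..?L}. g (l + 1))"
    by (simp add: rho_point_def g_def prod_dividef algebra_simps)
  also have "(\<Prod>l\<in>{1..?L}. g (l + 1)) = (\<Prod>l\<in>{2..<2 + ?L}. g l)"
    by (rule prod.reindex_bij_witness[of _ "\<lambda>l. l - 1" "\<lambda>l. l + 1"]) auto
  also have "\<dots> = (\<Prod>l\<in>{1..?L}. g l)"
    by (rule prod_period[OF g L_pos])
  finally have "(\<Prod>l\<in>{1..?L}. rho_point m n k (l, i + 1 - l)) = 1"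
    using g_nz by simp
  then show "rho m n k (R_hat m n k i ?q) = rho m n k ?q"
    unfolding R by (rule rho_local_R_trivial)
qed

text \<open>The snake factor depends only on \<open>j + i\<close>, and the two variables in a
  coordinate of rho have the same index sum, so the factors cancel.\<close>

lemma snake_trivial:
  assumes "c \<noteq> 0"
  shows "substitutable_tuple (snake m n k (rconst c) s (generic m n k)) (rho m n k (generic m n k))"
    and "pullback (snake m n k (rconst c) s (generic m n k)) (rho m n k (generic m n k)) =
      rho m n k (generic m n k)"
proof -
  let ?q = "generic m n k" and ?M = "gcd n (m + k)"
  \<comment> \<open>The factor as a function of \<open>a = j + i\<close>: the two congruences on
    \<open>i\<close> become congruences of \<open>a\<close> to \<open>s + 1\<close> and to
    \<open>s\<close>.\<close>
  define \<kappa> where "\<kappa> a = (if ?M dvd a - (s + 1) then rconst c else 1) *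
    (if ?M dvd a - s then inverse (rconst c) else 1)" for a
  define T where "T = snake m n k (rconst c) s ?q"
  have T: "T z = ?q z * \<kappa> (fst z + snd z)" for z
    by (cases z) (simp add: T_def snake_def Let_def \<kappa>_def mod_eq_dvd_iff algebra_simps)
  have "rconst c \<noteq> 0"
    using assms rconst_inject[of c 0] by simp
  then have \<kappa>_nz: "\<kappa> a \<noteq> 0" for a
    by (simp add: \<kappa>_def)
  have q_nz: "?q z \<noteq> 0" for z
    by (intro positive_at_1_nonzero positive_generic)
  have T_nz: "T z \<noteq> 0" for z
    by (simp add: T \<kappa>_nz q_nz)
  have T_inv: "invariant T"
    unfolding invariant_def
  proof (intro allI impI)
    fix z z' assume eq: "r z = r z'"
    then obtain t u where "z' = z + (m * t, k * t + n * u)"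
      unfolding rep_eq_iff by blast
    then have "fst z' + snd z' = fst z + snd z + ((m + k) * t + n * u)"
      by (simp add: algebra_simps)
    then have sum: "fst z' + snd z' - a = fst z + snd z - a + ((m + k) * t + n * u)" for a
      by simp
    \<comment> \<open>The lattice generators have coordinate sums \<open>m + k\<close> and
      \<open>n\<close>, both multiples of \<open>?M\<close>.\<close>
    have "?M dvd (m + k) * t + n * u"
      by simp
    then have "?M dvd fst z' + snd z' - a \<longleftrightarrow> ?M dvd fst z + snd z - a" for a
      unfolding sum by (rule dvd_add_left_iff)
    then show "T z = T z'"
      using invariantD[OF invariant_generic eq] by (simp add: T \<kappa>_def)
  qed
  show "substitutable_tuple T (rho m n k ?q)"
    by (rule pullback_rho[OF T_inv T_nz])
  have "T (z + (0, 1)) / T (z + (1, 0)) = rho_point m n k z" for z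
    using \<kappa>_nz by (cases z) (simp add: T rho_point_def algebra_simps)
  then show "pullback T (rho m n k ?q) = rho m n k ?q"
    unfolding pullback_rho(2)[OF T_inv T_nz] by (simp add: rho_generic)
qed

end

theorem proposition11p3:
  fixes m n k :: int
  assumes "n \<ge> 2" and "m \<ge> 1" and "1 \<le> k" and "k \<le> n"
  shows "let x = generic m n k; q = generic m n k; N = gcd n k; M = gcd n (m + k) in
      (m \<ge> 2 \<longrightarrow> (\<forall>j\<in>{0..<m}.
         rho_defined m n k (R_bar m n k j x) \<and>
         substitutable_tuple (s_act m n k j q) (rho m n k x) \<and>
         rho m n k (R_bar m n k j x) = pullback (s_act m n k j q) (rho m n k x))) \<and>
      (N \<ge> 2 \<longrightarrow> (\<forall>i\<in>{0..<N}.
         rho_defined m n k (R_tilde m n k i x) \<and>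
         substitutable_tuple (s_tilde m n k i q) (rho m n k x) \<and>
         rho m n k (R_tilde m n k i x) = pullback (s_tilde m n k i q) (rho m n k x))) \<and>
      (M \<ge> 2 \<longrightarrow> (\<forall>i\<in>{1..M}.
         rho_defined m n k (R_hat m n k i x) \<and>
         rho m n k (R_hat m n k i x) = rho m n k x)) \<and>
      (\<forall>c::complex. c \<noteq> 0 \<longrightarrow> (\<forall>i\<in>{1..M}.
         substitutable_tuple (snake m n k (rconst c) i q) (rho m n k x) \<and>
         pullback (snake m n k (rconst c) i q) (rho m n k x) = rho m n k x))"
proof -
  interpret torus m n k
    using assms by unfold_locales auto
  show ?thesis
    unfolding Let_def
    using R_bar_intertwine R_tilde_intertwine R_hat_trivial snake_trivial by blast
qed

end
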